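(* Let $f:[0,1]\to\mathbb{R}$ be such that $f\in C^2([0,1])$, $f(0)=f(1)=0$ and $f''(0)=f''(1)=0$. Then the unique bounded solution $u_1:[0,1]\times[0,\infty)\to\mathbb{R}$ of the problem $$\frac{\partial u}{\partial t}(x,t)-\frac{\partial^2 u}{\partial x^2}(x,t)=0,\quad t>0,\ x\in(0,1),$$ $$u(0,t)=u(1,t)=0,\quad t>0,\qquad u(x,0)=f(x),\quad x\in[0,1],$$ is given by the expression $$u_1(x,t)=\mathrm{P.V.}\,\frac{1}{2\pi}\int_{-\infty}^{\infty}\int_0^1 e^{ist}\,g(\sqrt{is},x,y)\,f(y)\,dy\,ds .$$
   Context: A solution is a function $u:[0,1]\times[0,\infty)\to\mathbb{R}$ with $u,\,u_t,\,u_{xx}\in C([0,1]\times[0,\infty))$ satisfying the equation, the boundary conditions and the initial condition. Under the stated hypotheses it is well known that there is a unique bounded solution. The principal value means $\mathrm{P.V.}\,\frac{1}{2\pi}\int_{-\infty}^{\infty}h(s)\,ds:=\lim_{M\to\infty}\frac{1}{2\pi}\int_{-M}^{M}h(s)\,ds$. The function $g$ is defined for $x,y\in[0,1]$ and complex $m\neq0$ (with $\sinh m\neq 0$) by $$g(m,x,y)=\frac{-1}{m\sinh m}\begin{cases}\sinh(m(x-1))\,\sinh(my), & 0\le y\le x\le 1,\\ \sinh(mx)\,\sinh(m(y-1)), & 0\le x<y\le 1,\end{cases}$$ and for $m=0$ by $$g(0,x,y)=\begin{cases}(1-x)\,y, & 0\le y\le x\le 1,\\ x\,(1-y), & 0\le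 x<y\le 1.\end{cases}$$ For $s\in\mathbb{R}$, $\sqrt{is}$ denotes a complex square root of $is$, i.e. a complex number $m$ with $m^2=is$. Since $g(-m,x,y)=g(m,x,y)$, the value $g(\sqrt{is},x,y)$ does not depend on which of the two square roots is chosen.
   Formalization: The integral expression for u_1(x,t) is claimed only for t>0 (all x in [0,1]); at t=0 it fails, e.g. for f(y)=sin(πy) the principal value gives f(x)/2 instead of u_1(x,0)=f(x). *)

theory Defs
  imports "HOL-Analysis.Analysis"
begin

(* Derivatives are taken within the domain, hence one-sided at its boundary points, so that
   "C^2 on [0,1]" and "u_t, u_xx continuous on [0,1] x [0,\<infinity>)" make sense up to the
   boundary.  Values of functions outside their domain play no role. *)

definition deriv_within :: "real set \<Rightarrow> (real \<Rightarrow> real) \<Rightarrow> real \<Rightarrow> real" where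
  "deriv_within S f x = vector_derivative f (at x within S)"

lemma deriv_within_eqI:
  assumes "(f has_real_derivative d) (at x within {a..b})" "a < b" "x \<in> {a..b}"
  shows "deriv_within {a..b} f x = d"
  using assms unfolding deriv_within_def
  by (intro vector_derivative_within_closed_interval)
    (auto simp: has_real_derivative_iff_has_vector_derivative)

definition twice_differentiable_on :: "(real \<Rightarrow> real) \<Rightarrow> real set \<Rightarrow> bool"
    (infix "twice'_differentiable'_on" 50) where
  "f twice_differentiable_on S \<longleftrightarrow>
     f differentiable_on S \<and> deriv_within S f differentiable_on S"

definition C2_on :: "(real \<Rightarrow> real) \<Rightarrow> real set \<Rightarrow> bool" where
  "C2_on f S \<longleftrightarrow> f twice_differentiable_on S \<and>
     continuous_on S (deriv_within S (deriv_within S f))"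

abbreviation dt :: "(real \<Rightarrow> real \<Rightarrow> real) \<Rightarrow> real \<Rightarrow> real \<Rightarrow> real" where
  "dt u x t \<equiv> deriv_within {0..} (\<lambda>\<tau>. u x \<tau>) t"

abbreviation dxx :: "(real \<Rightarrow> real \<Rightarrow> real) \<Rightarrow> real \<Rightarrow> real \<Rightarrow> real" where
  "dxx u x t \<equiv> deriv_within {0..1} (deriv_within {0..1} (\<lambda>\<xi>. u \<xi> t)) x"

definition heat_solution :: "(real \<Rightarrow> real) \<Rightarrow> (real \<Rightarrow> real \<Rightarrow> real) \<Rightarrow> bool" where
  "heat_solution f u \<longleftrightarrow>
     continuous_on ({0..1} \<times> {0..}) (\<lambda>(x, t). u x t) \<and>
     (\<forall>x\<in>{0..1}. (\<lambda>\<tau>. u x \<tau>) differentiable_on {0..}) \<and>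
     continuous_on ({0..1} \<times> {0..}) (\<lambda>(x, t). dt u x t) \<and>
     (\<forall>t\<ge>0. (\<lambda>\<xi>. u \<xi> t) twice_differentiable_on {0..1}) \<and>
     continuous_on ({0..1} \<times> {0..}) (\<lambda>(x, t). dxx u x t) \<and>
     (\<forall>x\<in>{0<..<1}. \<forall>t>0. dt u x t - dxx u x t = 0) \<and>
     (\<forall>t>0. u 0 t = 0 \<and> u 1 t = 0) \<and>
     (\<forall>x\<in>{0..1}. u x 0 = f x)"

definition bounded_heat_solution :: "(real \<Rightarrow> real) \<Rightarrow> (real \<Rightarrow> real \<Rightarrow> real) \<Rightarrow> bool" where
  "bounded_heat_solution f u \<longleftrightarrow>
     heat_solution f u \<and> bounded ((\<lambda>(x, t). u x t) ` ({0..1} \<times> {0..}))"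

definition green :: "complex \<Rightarrow> real \<Rightarrow> real \<Rightarrow> complex" where
  "green m x y =
     (if m = 0 then of_real (if y \<le> x then (1 - x) * y else x * (1 - y))
      else - 1 / (m * sinh m) *
        (if y \<le> x then sinh (m * of_real (x - 1)) * sinh (m * of_real y)
         else sinh (m * of_real x) * sinh (m * of_real (y - 1))))"

(* Hence it does not matter which square root of i s is used as m. *)
lemma green_minus: "green (- m) x y = green m x y"
  by (simp add: green_def)

(* The factor 1 / (2 pi) is part of the definition.  Integrability is required explicitly because
   the integral of a non-integrable function is 0 by convention. *)
definition has_PV :: "(real \<Rightarrow> complex) \<Rightarrow> complex \<Rightarrow> bool" (infix "has'_PV" 46) where
  "h has_PV L \<longleftrightarrow>
     (\<forall>M. h integrable_on {-M..M}) \<and>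
     ((\<lambda>M. 1 / (2 * of_real pi) * integral {-M..M} h) \<longlongrightarrow> L) at_top"

end

theory Submission
  imports Defs "HOL-Complex_Analysis.Complex_Analysis" "HOL-Real_Asymp.Real_Asymp"
begin

text \<open>
Expand the solution in eigenfunctions of the Dirichlet problem: with \<open>p n = (n\<pi>)\<^sup>2\<close>,
\<open>u(x,t) = \<Sum>n. \<beta> n e\<^bsup>-p n t\<^esup> sin(n\<pi>x)\<close>, where \<open>\<beta> n = O(1/n\<^sup>2)\<close> because \<open>f\<close> is twice continuously
differentiable and vanishes at both ends. Integration against Green's function is the resolvent: it maps \<open>sin(n\<pi>y)\<close> to
\<open>sin(n\<pi>x)/(is + p n)\<close> (\<open>integral_green_sin\<close>). The inner integral is therefore
\<open>e\<^bsup>ist\<^esup> \<Sum>n. \<beta> n sin(n\<pi>x)/(is + p n)\<close>, that is, \<open>e\<^bsup>ist\<^esup>\<close> times the Laplace transform of \<open>u\<close> on the imaginary axis, and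
the principal value is Fourier inversion, mode by mode:
\<open>\<integral> e\<^bsup>ist\<^esup>/(is + a) ds\<close> over \<open>[-M, M]\<close> tends to \<open>2\<pi>e\<^bsup>-at\<^esup>\<close> (\<open>mode_integral_tendsto\<close>, by a half circle contour). These integrals
are bounded uniformly in \<open>M\<close> and in the mode (\<open>mode_integral_bound\<close>), so the limit may be exchanged with the
absolutely convergent sum (\<open>has_PV_sine_series\<close>).

The delicate point is regularity up to \<open>t = 0\<close>: the time derivative and the second space derivative must be continuous
on the closed strip although \<open>f''\<close> is merely continuous, so that its Fourier series need not converge. Here the maximum
principle replaces the series: \<open>f''\<close> vanishes at both ends and so is a uniform limit of sine polynomials, whose
evolutions are explicit and, by the maximum principle, converge uniformly in space and time
(\<open>heat_solution_exists\<close>). The maximum principle also gives uniqueness (\<open>heat_solution_unique\<close>).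
\<close>

section \<open>The maximum principle\<close>

lemma second_derivative_nonpos_at_max:
  fixes h h' :: "real \<Rightarrow> real"
  assumes x: "a < x" "x < b"
    and d1: "\<And>y. a < y \<Longrightarrow> y < b \<Longrightarrow> (h has_real_derivative h' y) (at y)"
    and d2: "(h' has_real_derivative h'') (at x)"
    and max: "\<And>y. a < y \<Longrightarrow> y < b \<Longrightarrow> h y \<le> h x"
  shows "h'' \<le> 0"
proof (rule ccontr)
  assume "\<not> h'' \<le> 0"
  then have pos: "h'' > 0" by simp
  have "h' x = 0"
    by (rule DERIV_local_max[OF d1[OF x], of "min (x - a) (b - x)"]) (use x max in \<open>auto simp: abs_if split: if_splits\<close>)
  obtain e where e: "e > 0" "\<And>y. 0 < y \<Longrightarrow> y < e \<Longrightarrow> h' x < h' (x + y)"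
    using DERIV_pos_inc_right[OF d2 pos] by blast
  define r where "r = min (e/2) ((b - x)/2)"
  have r: "r > 0" "r < e" "x + r < b" using x e by (auto simp: r_def min_def field_simps)
  have "h x < h (x + r)"
  proof (rule DERIV_pos_imp_increasing_open[of x "x + r" h])
    fix y assume y: "x < y" "y < x + r"
    have "h' y > 0" using e(2)[of "y - x"] y r \<open>h' x = 0\<close> by auto
    then show "\<exists>z. (h has_real_derivative z) (at y) \<and> 0 < z"
      using d1[of y] y x r by auto
  next
    show "continuous_on {x..x + r} h"
      by (rule DERIV_atLeastAtMost_imp_continuous_on) (use x r in \<open>auto intro!: exI d1\<close>)
  qed (use r in auto)
  with max[of "x + r"] x r show False by auto
qed

text \<open>Tilting by \<open>-et\<close> with a small \<open>e > 0\<close> keeps a value above \<open>K\<close>, and then the maximum over \<open>[0,1] \<times> [0,t]\<close> is attained at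
an interior \<open>x\<close> and a positive time. There the second space derivative is at most \<open>0\<close>, whereas the time
derivative is at least \<open>e\<close> (comparison with earlier times only, so that the top of the rectangle is allowed), which
contradicts the heat equation. The function \<open>v\<^sub>t\<close> appears both as time derivative and as second space derivative:
this is how the equation enters.\<close>
lemma heat_maximum_principle:
  fixes v v\<^sub>t v\<^sub>x :: "real \<Rightarrow> real \<Rightarrow> real"
  assumes cont: "continuous_on ({0..1} \<times> {0..}) (\<lambda>(x, t). v x t)"
    and dt: "\<And>x t. x \<in> {0<..<1} \<Longrightarrow> t > 0 \<Longrightarrow> (v x has_real_derivative v\<^sub>t x t) (at t)"
    and dx: "\<And>x t. x \<in> {0<..<1} \<Longrightarrow> t > 0 \<Longrightarrow> ((\<lambda>\<xi>. v \<xi> t) has_real_derivative v\<^sub>x x t) (at x)"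
    and dxx: "\<And>x t. x \<in> {0<..<1} \<Longrightarrow> t > 0 \<Longrightarrow> ((\<lambda>\<xi>. v\<^sub>x \<xi> t) has_real_derivative v\<^sub>t x t) (at x)"
    and bd: "\<And>t. t > 0 \<Longrightarrow> v 0 t \<le> K" "\<And>t. t > 0 \<Longrightarrow> v 1 t \<le> K"
    and init: "\<And>x. x \<in> {0..1} \<Longrightarrow> v x 0 \<le> K"
    and x: "x \<in> {0..1}" and t: "t \<ge> 0"
  shows "v x t \<le> K"
proof (rule ccontr)
  assume "\<not> v x t \<le> K"
  then have gt: "v x t > K" by simp
  define e where "e = (v x t - K) / (2 * (t + 1))"
  have e: "e > 0" using gt t by (simp add: e_def)
  have et: "v x t - e * t > K"
  proof -
    have "e * t = (v x t - K) * (t / (2 * (t + 1)))" by (simp add: e_def)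
    also have "\<dots> < (v x t - K) * 1"
      using gt t by (intro mult_strict_left_mono) (auto simp: field_simps)
    finally show ?thesis by simp
  qed
  define Q where "Q = {0..1::real} \<times> {0..t}"
  have "continuous_on Q (\<lambda>(x, t). v x t)"
    by (rule continuous_on_subset[OF cont]) (auto simp: Q_def)
  then have "continuous_on Q (\<lambda>p. v (fst p) (snd p) - e * snd p)"
    by (intro continuous_intros) (simp add: case_prod_unfold)
  moreover have "compact Q" "Q \<noteq> {}" using t by (auto simp: Q_def intro!: compact_Times)
  ultimately obtain p where p: "p \<in> Q" "\<And>q. q \<in> Q \<Longrightarrow> v (fst q) (snd q) - e * snd q \<le> v (fst p) (snd p) - e * snd p"
    using continuous_attains_sup[of Q] by blast
  obtain y s where ys: "p = (y, s)" by (cases p)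
  have y: "y \<in> {0..1}" and s: "s \<in> {0..t}" using p by (auto simp: ys Q_def)
  have mx: "v z r - e * r \<le> v y s - e * s" if "z \<in> {0..1}" "r \<in> {0..t}" for z r
    using p(2)[of "(z, r)"] that by (simp add: ys Q_def)
  have big: "v y s - e * s > K" using mx[of x t] x t et by simp
  moreover have "e * s \<ge> 0" using e s by simp
  ultimately have bigs: "v y s > K" by linarith
  have s0: "s > 0" using init[OF y] bigs s by (cases "s = 0") auto
  have y01: "y \<in> {0<..<1}" using bd[OF s0] bigs y by (cases "y = 0"; cases "y = 1") auto
  have "v\<^sub>t y s \<le> 0"
    by (rule second_derivative_nonpos_at_max[of 0 y 1 "\<lambda>\<xi>. v \<xi> s" "\<lambda>\<xi>. v\<^sub>x \<xi> s"])
      (use y01 s s0 dx dxx mx[of _ s] in auto)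
  moreover have "v\<^sub>t y s \<ge> e"
  proof (rule ccontr)
    assume "\<not> v\<^sub>t y s \<ge> e"
    then have neg: "v\<^sub>t y s - e < 0" by simp
    have "((\<lambda>r. v y r - e * r) has_real_derivative v\<^sub>t y s - e) (at s)"
      using dt[OF y01 s0] by (auto intro!: derivative_eq_intros)
    from DERIV_neg_dec_left[OF this neg] obtain d where d: "d > 0"
      "\<And>h. 0 < h \<Longrightarrow> h < d \<Longrightarrow> v y s - e * s < v y (s - h) - e * (s - h)" by blast
    define h where "h = min (d/2) (s/2)"
    have "h > 0" "h < d" "s - h \<in> {0..t}" using d s s0 by (auto simp: h_def min_def)
    then show False using d(2)[of h] mx[of y "s - h"] y by auto
  qed
  ultimately show False using e by simp
qed

text \<open>By Rolle's theorem \<open>h'\<close> has a zero, so the mean value inequality, applied to \<open>h'\<close> and then to \<open>h\<close>, carries a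
bound on \<open>h''\<close> down to \<open>h'\<close> and \<open>h\<close>. It reduces all convergence questions to second space derivatives.\<close>
lemma bounds_from_second_derivative:
  fixes h h' h'' :: "real \<Rightarrow> real"
  assumes d1: "\<And>x. x \<in> {0..1} \<Longrightarrow> (h has_real_derivative h' x) (at x within {0..1})"
    and d2: "\<And>x. x \<in> {0..1} \<Longrightarrow> (h' has_real_derivative h'' x) (at x within {0..1})"
    and ends: "h 0 = 0" "h 1 = 0"
    and bound: "\<And>x. x \<in> {0..1} \<Longrightarrow> \<bar>h'' x\<bar> \<le> e"
    and x: "x \<in> {0..1}"
  shows "\<bar>h' x\<bar> \<le> e" and "\<bar>h x\<bar> \<le> e"
proof -
  have lip: "\<bar>k z - k y\<bar> \<le> e"
    if "\<And>x. x \<in> {0..1} \<Longrightarrow> (k has_real_derivative k' x) (at x within {0..1})"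
      "\<And>x. x \<in> {0..1} \<Longrightarrow> \<bar>k' x\<bar> \<le> e" "y \<in> {0..1}" "z \<in> {0..1}" for k k' :: "real \<Rightarrow> real" and y z
  proof -
    have "norm (k z - k y) \<le> e * norm (z - y)"
      by (rule field_differentiable_bound[of "{0..1}" k k']) (use that in auto)
    also have "\<dots> \<le> e * 1"
    proof (rule mult_left_mono)
      show "0 \<le> e" using order_trans[OF abs_ge_zero that(2)[of 0]] by simp
    qed (use that in auto)
    finally show ?thesis by simp
  qed
  obtain c where c: "0 < c" "c < 1" "h 1 - h 0 = (1 - 0) * h' c"
  proof -
    have "\<exists>c>0. c < 1 \<and> h 1 - h 0 = (1 - 0) * h' c"
      using mvt_simple[of 0 1 h "\<lambda>x y. h' x * y"] d1
      by (auto simp: has_field_derivative_def)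
    with that show thesis by blast
  qed
  then have c0: "h' c = 0" using ends by simp
  have b1: "\<bar>h' x\<bar> \<le> e" if "x \<in> {0..1}" for x
    using lip[OF d2 bound, of c x] c c0 that by auto
  show "\<bar>h' x\<bar> \<le> e" by (rule b1[OF x])
  show "\<bar>h x\<bar> \<le> e" using lip[OF d1 b1, of 0 x] ends x by auto
qed

section \<open>Uniform approximation by sine polynomials\<close>

definition sine_polynomial :: "(real \<Rightarrow> real) \<Rightarrow> bool" where
  "sine_polynomial h \<longleftrightarrow> (\<exists>N a. \<forall>x. h x = (\<Sum>n\<le>N. a n * sin (real n * pi * x)))"

lemma sine_polynomial_sin: "sine_polynomial (\<lambda>x. c * sin (real n * pi * x))"
  unfolding sine_polynomial_def
  by (rule exI[of _ n], rule exI[of _ "\<lambda>k. if k = n then c else 0"]) (simp add: if_distrib[of "\<lambda>y. y * _"] cong: if_cong)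

lemma sine_polynomial_add:
  assumes "sine_polynomial h" "sine_polynomial k"
  shows "sine_polynomial (\<lambda>x. h x + k x)"
proof -
  obtain N a where h: "\<And>x. h x = (\<Sum>n\<le>N. a n * sin (real n * pi * x))"
    using assms(1) unfolding sine_polynomial_def by blast
  obtain M b where k: "\<And>x. k x = (\<Sum>n\<le>M. b n * sin (real n * pi * x))"
    using assms(2) unfolding sine_polynomial_def by blast
  have extend: "(\<Sum>n\<le>L. c n * sin (real n * pi * x)) = (\<Sum>n\<le>max N M. (if n \<le> L then c n else 0) * sin (real n * pi * x))"
    if "L \<le> max N M" for L c x
    using that by (intro sum.mono_neutral_cong_left) auto
  have eq: "h x + k x = (\<Sum>n\<le>max N M. ((if n \<le> N then a n else 0) + (if n \<le> M then b n else 0)) * sin (real n * pi * x))" for x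
    unfolding h k by (subst (1 2) extend) (simp_all only: max.cobounded1 max.cobounded2 distrib_right sum.distrib)
  show ?thesis unfolding sine_polynomial_def by (intro exI allI) (rule eq)
qed

lemma sine_polynomial_sum:
  assumes "finite A" "\<And>i. i \<in> A \<Longrightarrow> sine_polynomial (h i)"
  shows "sine_polynomial (\<lambda>x. \<Sum>i\<in>A. h i x)"
  using assms
proof (induction A rule: finite_induct)
  case empty
  show ?case using sine_polynomial_sin[of 0] by simp
next
  case (insert i A)
  then show ?case by (simp add: sine_polynomial_add)
qed

lemma sine_polynomial_scale:
  assumes "sine_polynomial h"
  shows "sine_polynomial (\<lambda>x. c * h x)"
proof -
  obtain N a where h: "\<And>x. h x = (\<Sum>n\<le>N. a n * sin (real n * pi * x))"
    using assms unfolding sine_polynomial_def by blast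
  have "sine_polynomial (\<lambda>x. \<Sum>n\<le>N. (c * a n) * sin (real n * pi * x))"
    by (intro sine_polynomial_sum sine_polynomial_sin) simp
  then show ?thesis by (simp add: h sum_distrib_left mult.assoc)
qed

text \<open>The product formula \<open>2 cos(\<pi>x) sin(n\<pi>x) = sin((n+1)\<pi>x) + sin((n-1)\<pi>x)\<close> makes the sine polynomials a module over
the polynomials in \<open>cos(\<pi>x)\<close>.\<close>
lemma sine_polynomial_times_cos:
  assumes "sine_polynomial h"
  shows "sine_polynomial (\<lambda>x. cos (pi * x) * h x)"
proof -
  obtain N a where h: "\<And>x. h x = (\<Sum>n\<le>N. a n * sin (real n * pi * x))"
    using assms unfolding sine_polynomial_def by blast
  have mode: "sine_polynomial (\<lambda>x. c * (cos (pi * x) * sin (real n * pi * x)))" for n c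
  proof (cases n)
    case 0
    then show ?thesis using sine_polynomial_sin[of 0] by simp
  next
    case (Suc m)
    have "c * (cos (pi * x) * sin (real n * pi * x))
        = c / 2 * sin (real (Suc n) * pi * x) + c / 2 * sin (real m * pi * x)" for x
    proof -
      have "sin (real (Suc n) * pi * x) = sin (real n * pi * x + pi * x)"
        "sin (real m * pi * x) = sin (real n * pi * x - pi * x)"
        by (simp_all add: Suc algebra_simps)
      then show ?thesis by (simp only: sin_add sin_diff) (simp add: algebra_simps)
    qed
    then show ?thesis by (simp only:) (intro sine_polynomial_add sine_polynomial_sin)
  qed
  have "sine_polynomial (\<lambda>x. \<Sum>n\<le>N. a n * (cos (pi * x) * sin (real n * pi * x)))"
    by (intro sine_polynomial_sum mode) simp
  then show ?thesis by (simp add: h sum_distrib_left mult_ac)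
qed

text \<open>Sine polynomials are not an algebra, so the Stone-Weierstrass theorem is applied to the ring of their multipliers.
This ring contains the injective function \<open>cos(\<pi>x)\<close> and is therefore dense. It remains to write \<open>g\<close>, up to a
small error, as \<open>sin(\<pi>x)\<close> times a continuous function; since \<open>g\<close> vanishes at both ends,
\<open>sin(\<pi>x) g/(sin(\<pi>x) + \<delta>)\<close> does this for small \<open>\<delta>\<close>.\<close>
lemma sine_polynomial_approximation:
  fixes g :: "real \<Rightarrow> real"
  assumes cont: "continuous_on {0..1} g" and ends: "g 0 = 0" "g 1 = 0" and e: "e > 0"
  obtains P where "sine_polynomial P" "\<And>x. x \<in> {0..1} \<Longrightarrow> \<bar>g x - P x\<bar> < e"
proof -
  define S :: "real \<Rightarrow> real" where "S = (\<lambda>x. sin (pi * x))"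
  have S0: "S x \<ge> 0" if "x \<in> {0..1}" for x
    using that unfolding S_def by (intro sin_ge_zero) auto
  have contS: "continuous_on X S" for X unfolding S_def by (intro continuous_intros)
  have "bounded (g ` {0..1})" using cont by (intro compact_imp_bounded compact_continuous_image) auto
  then obtain B where B: "B > 0" "\<And>x. x \<in> {0..1} \<Longrightarrow> \<bar>g x\<bar> \<le> B"
    by (auto simp: bounded_pos)
  \<comment> \<open>Away from \<open>K\<close> the function \<open>g\<close> is itself small; on the compact set \<open>K\<close> the sine is bounded below.\<close>
  define K where "K = {x \<in> {0..1}. \<bar>g x\<bar> \<ge> e / 2}"
  obtain \<mu> where \<mu>: "\<mu> > 0" "\<And>x. x \<in> K \<Longrightarrow> S x \<ge> \<mu>"
  proof (cases "K = {}")
    case True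
    with that[of 1] show ?thesis by simp
  next
    case False
    have "K = {0..1} \<inter> (\<lambda>x. \<bar>g x\<bar>) -` {e / 2..}" by (auto simp: K_def)
    moreover have "closed ({0..1} \<inter> (\<lambda>x. \<bar>g x\<bar>) -` {e / 2..})"
      by (intro continuous_closed_preimage continuous_intros cont)
    moreover have "bounded K" by (rule bounded_subset[of "{0..1}"]) (auto simp: K_def)
    ultimately have "compact K" by (simp add: compact_eq_bounded_closed)
    then obtain y where y: "y \<in> K" "\<And>x. x \<in> K \<Longrightarrow> S y \<le> S x"
      using continuous_attains_inf[OF _ False contS] by blast
    have "y \<noteq> 0" "y \<noteq> 1" using y(1) e ends by (auto simp: K_def)
    then have "0 < pi * y" "pi * y < pi" using y(1) by (auto simp: K_def)
    then have "S y > 0" unfolding S_def by (rule sin_gt_zero)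
    with y that[of "S y"] show ?thesis by blast
  qed
  define \<delta> where "\<delta> = e * \<mu> / (2 * B)"
  have \<delta>: "\<delta> > 0" using e \<mu> B by (simp add: \<delta>_def)
  define \<phi> where "\<phi> x = g x / (S x + \<delta>)" for x
  have Sd: "S x + \<delta> > 0" if "x \<in> {0..1}" for x using S0[OF that] \<delta> by linarith
  have near: "\<bar>g x - S x * \<phi> x\<bar> \<le> e / 2" if x: "x \<in> {0..1}" for x
  proof -
    have "g x - S x * \<phi> x = g x * (\<delta> / (S x + \<delta>))"
      using Sd[OF x] by (simp add: \<phi>_def field_simps)
    then have eq: "\<bar>g x - S x * \<phi> x\<bar> = \<bar>g x\<bar> * (\<delta> / (S x + \<delta>))"
      using Sd[OF x] \<delta> by (simp add: abs_mult)
    show ?thesis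
    proof (cases "x \<in> K")
      case True
      have "\<bar>g x\<bar> * (\<delta> / (S x + \<delta>)) \<le> B * (\<delta> / \<mu>)"
        using \<mu>(2)[OF True] \<mu>(1) \<delta> B(1) B(2)[OF x] by (intro mult_mono divide_left_mono) auto
      also have "\<dots> = e / 2" using B \<mu> by (simp add: \<delta>_def)
      finally show ?thesis using eq by simp
    next
      case False
      have "\<bar>g x\<bar> * (\<delta> / (S x + \<delta>)) \<le> (e / 2) * 1"
        using False x S0[OF x] \<delta> e by (intro mult_mono) (auto simp: K_def)
      then show ?thesis using eq by simp
    qed
  qed
  define R where "R = {p. continuous_on {0..1} p \<and> (\<forall>h. sine_polynomial h \<longrightarrow> sine_polynomial (\<lambda>x. p x * h x))}"
  interpret function_ring_on R "{0..1::real}"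
  proof
    fix x y :: real assume xy: "x \<in> {0..1}" "y \<in> {0..1}" "x \<noteq> y"
    have "(\<lambda>x. cos (pi * x)) \<in> R"
      unfolding R_def using sine_polynomial_times_cos by (simp add: continuous_intros)
    moreover have "cos (pi * x) \<noteq> cos (pi * y)"
      using cos_inj_pi[of "pi * x" "pi * y"] xy by (auto simp: mult_left_le)
    ultimately show "\<exists>f\<in>R. f x \<noteq> f y" by (intro bexI[of _ "\<lambda>x. cos (pi * x)"])
  next
    fix p q assume pq: "p \<in> R" "q \<in> R"
    then have c: "continuous_on {0..1} p" "continuous_on {0..1} q" by (auto simp: R_def)
    have "sine_polynomial (\<lambda>x. p x * h x + q x * h x)" "sine_polynomial (\<lambda>x. p x * (q x * h x))"
      if "sine_polynomial h" for h
      using pq that by (simp_all add: R_def sine_polynomial_add)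
    then show "(\<lambda>x. p x + q x) \<in> R" "(\<lambda>x. p x * q x) \<in> R"
      using c by (simp_all add: R_def distrib_right mult.assoc continuous_on_add continuous_on_mult)
  qed (simp_all add: R_def sine_polynomial_scale)
  have "continuous_on {0..1} \<phi>"
    unfolding \<phi>_def using Sd by (intro continuous_intros cont contS) force
  then obtain p where p: "p \<in> R" "\<And>x. x \<in> {0..1} \<Longrightarrow> \<bar>\<phi> x - p x\<bar> < e / 2"
    using Stone_Weierstrass_basic[of \<phi> "e / 2"] e by auto
  have "sine_polynomial S"
    using sine_polynomial_sin[of 1 1] by (simp add: S_def)
  then have "sine_polynomial (\<lambda>x. p x * S x)" using p(1) by (simp add: R_def)
  moreover have "\<bar>g x - p x * S x\<bar> < e" if x: "x \<in> {0..1}" for x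
  proof -
    have "\<bar>S x * (\<phi> x - p x)\<bar> \<le> 1 * \<bar>\<phi> x - p x\<bar>"
      unfolding abs_mult by (intro mult_right_mono) (auto simp: S_def)
    then have "\<bar>S x * \<phi> x - p x * S x\<bar> < e / 2" using p(2)[OF x] by (simp add: algebra_simps)
    with near[OF x] show ?thesis by linarith
  qed
  ultimately show thesis by (rule that)
qed

section \<open>Heat flows and uniqueness\<close>

text \<open>The third argument serves both as the time derivative and as the second space derivative of the first. The initial
values are left open, so that differences of flows can be compared through them.\<close>
definition heat_flow :: "(real \<Rightarrow> real \<Rightarrow> real) \<Rightarrow> (real \<Rightarrow> real \<Rightarrow> real) \<Rightarrow> (real \<Rightarrow> real \<Rightarrow> real) \<Rightarrow> bool" where
  "heat_flow v v\<^sub>x v\<^sub>t \<longleftrightarrow>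
     continuous_on ({0..1} \<times> {0..}) (\<lambda>(x, t). v x t) \<and>
     (\<forall>x\<in>{0<..<1}. \<forall>t>0. (v x has_real_derivative v\<^sub>t x t) (at t) \<and>
        ((\<lambda>\<xi>. v \<xi> t) has_real_derivative v\<^sub>x x t) (at x) \<and>
        ((\<lambda>\<xi>. v\<^sub>x \<xi> t) has_real_derivative v\<^sub>t x t) (at x)) \<and>
     (\<forall>t>0. v 0 t = 0 \<and> v 1 t = 0)"

lemma heat_flow_difference_bound:
  assumes v: "heat_flow v v\<^sub>x v\<^sub>t" and w: "heat_flow w w\<^sub>x w\<^sub>t"
    and init: "\<And>x. x \<in> {0..1} \<Longrightarrow> \<bar>v x 0 - w x 0\<bar> \<le> K"
    and x: "x \<in> {0..1}" and t: "t \<ge> 0"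
  shows "\<bar>v x t - w x t\<bar> \<le> K"
proof -
  have one_sided: "v x t - w x t \<le> K"
    if v: "heat_flow v v\<^sub>x v\<^sub>t" and w: "heat_flow w w\<^sub>x w\<^sub>t"
      and init: "\<And>x. x \<in> {0..1} \<Longrightarrow> \<bar>v x 0 - w x 0\<bar> \<le> K" for v v\<^sub>x v\<^sub>t w w\<^sub>x w\<^sub>t
  proof (rule heat_maximum_principle[where v\<^sub>t = "\<lambda>x t. v\<^sub>t x t - w\<^sub>t x t" and v\<^sub>x = "\<lambda>x t. v\<^sub>x x t - w\<^sub>x x t" and v = "\<lambda>x t. v x t - w x t"])
    show "continuous_on ({0..1} \<times> {0..}) (\<lambda>(x, t). v x t - w x t)"
      using continuous_on_diff[of "{0..1} \<times> {0..}" "\<lambda>(x, t). v x t" "\<lambda>(x, t). w x t"] v w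
      by (simp add: heat_flow_def case_prod_unfold)
    have "0 \<le> K" using order_trans[OF abs_ge_zero init[of 0]] by simp
    then show "v 0 t - w 0 t \<le> K" "v 1 t - w 1 t \<le> K" if "t > 0" for t
      using v w that by (auto simp: heat_flow_def)
    show "v x 0 - w x 0 \<le> K" if "x \<in> {0..1}" for x using init[OF that] by linarith
  qed (use v w x t in \<open>simp_all add: heat_flow_def DERIV_diff\<close>)
  have "v x t - w x t \<le> K" by (rule one_sided[OF v w init])
  moreover have "w x t - v x t \<le> K"
    by (rule one_sided[OF w v]) (use init in \<open>auto simp: abs_minus_commute\<close>)
  ultimately show ?thesis by linarith
qed

text \<open>The solution of the heat equation whose initial value is the sine polynomial with coefficients \<open>a 0, ..., a N\<close>.\<close>
definition sine_evolution :: "(nat \<Rightarrow> real) \<Rightarrow> nat \<Rightarrow> real \<Rightarrow> real \<Rightarrow> real" where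
  "sine_evolution a N x t = (\<Sum>n\<le>N. a n * exp (- ((real n * pi)^2) * t) * sin (real n * pi * x))"

definition sine_evolution_dx :: "(nat \<Rightarrow> real) \<Rightarrow> nat \<Rightarrow> real \<Rightarrow> real \<Rightarrow> real" where
  "sine_evolution_dx a N x t = (\<Sum>n\<le>N. a n * exp (- ((real n * pi)^2) * t) * (cos (real n * pi * x) * (real n * pi)))"

lemma sine_evolution_continuous: "continuous_on S (\<lambda>(x, t). sine_evolution a N x t)"
  unfolding sine_evolution_def case_prod_unfold by (intro continuous_intros)

lemma sine_evolution_has_dt:
  "((\<lambda>t. sine_evolution a N x t) has_real_derivative sine_evolution (\<lambda>n. - ((real n * pi)^2) * a n) N x t) (at t within S)"
  unfolding sine_evolution_def
  by (rule DERIV_sum) (auto intro!: derivative_eq_intros)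

lemma sine_evolution_has_dx:
  "((\<lambda>x. sine_evolution a N x t) has_real_derivative sine_evolution_dx a N x t) (at x within S)"
  unfolding sine_evolution_def sine_evolution_dx_def
  by (rule DERIV_sum) (auto intro!: derivative_eq_intros)

lemma sine_evolution_dx_has_dx:
  "((\<lambda>x. sine_evolution_dx a N x t) has_real_derivative sine_evolution (\<lambda>n. - ((real n * pi)^2) * a n) N x t) (at x within S)"
  unfolding sine_evolution_def sine_evolution_dx_def
  by (rule DERIV_sum) (auto intro!: derivative_eq_intros simp: power2_eq_square)

lemma sine_evolution_boundary: "sine_evolution a N 0 t = 0" "sine_evolution a N 1 t = 0"
  by (simp_all add: sine_evolution_def)

lemma sine_evolution_heat_flow:
  "heat_flow (sine_evolution a N) (sine_evolution_dx a N) (sine_evolution (\<lambda>n. - ((real n * pi)^2) * a n) N)"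
  unfolding heat_flow_def
  using sine_evolution_has_dt[of a N _ _ UNIV] sine_evolution_has_dx[of a N _ _ UNIV] sine_evolution_dx_has_dx[of a N _ _ UNIV]
  by (simp add: sine_evolution_boundary sine_evolution_continuous)

text \<open>Dividing the coefficients by \<open>-(n\<pi>)\<^sup>2\<close> inverts the second space derivative. At \<open>n = 0\<close> the division gives \<open>0\<close>, which is
harmless because the corresponding sine vanishes.\<close>
lemma sine_evolution_antiderivative:
  "sine_evolution (\<lambda>n. - ((real n * pi)^2) * (- a n / (real n * pi)^2)) N = sine_evolution a N"
  unfolding sine_evolution_def by (intro ext sum.cong) auto

text \<open>A uniform Cauchy estimate passes to the limit with the same rate; applied pointwise it gives uniform convergence.\<close>
lemma Cauchy_with_rate:
  fixes s :: "nat \<Rightarrow> real"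
  assumes eps: "\<epsilon> \<longlonglongrightarrow> 0" and rate: "\<And>j k. \<bar>s k - s j\<bar> \<le> \<epsilon> k + \<epsilon> j"
  shows "s \<longlonglongrightarrow> lim s" and "\<bar>s k - lim s\<bar> \<le> \<epsilon> k"
proof -
  have "Cauchy s"
  proof (rule CauchyI)
    fix e :: real assume "e > 0"
    then obtain M where M: "\<And>n. n \<ge> M \<Longrightarrow> \<bar>\<epsilon> n\<bar> < e / 2"
      using LIMSEQ_D[OF eps, of "e/2"] by auto
    have "norm (s m - s n) < e" if "m \<ge> M" "n \<ge> M" for m n
      using rate[of m n] M[of m] M[of n] that unfolding real_norm_def by linarith
    then show "\<exists>M. \<forall>m\<ge>M. \<forall>n\<ge>M. norm (s m - s n) < e" by blast
  qed
  then show lim: "s \<longlonglongrightarrow> lim s" by (simp add: Cauchy_convergent_iff convergent_LIMSEQ_iff)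
  have "(\<lambda>j. \<bar>s k - s j\<bar>) \<longlonglongrightarrow> \<bar>s k - lim s\<bar>" by (intro tendsto_intros lim)
  moreover have "(\<lambda>j. \<epsilon> k + \<epsilon> j) \<longlonglongrightarrow> \<epsilon> k + 0" by (intro tendsto_intros eps)
  ultimately have "\<bar>s k - lim s\<bar> \<le> \<epsilon> k + 0"
    by (rule LIMSEQ_le) (use rate in blast)
  then show "\<bar>s k - lim s\<bar> \<le> \<epsilon> k" by simp
qed

lemma uniform_limit_of_rate:
  fixes F :: "nat \<Rightarrow> 'a \<Rightarrow> real"
  assumes "\<epsilon> \<longlonglongrightarrow> 0" "\<And>k x. x \<in> S \<Longrightarrow> \<bar>F k x - G x\<bar> \<le> \<epsilon> k"
  shows "uniform_limit S F G sequentially"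
proof (rule uniform_limitI)
  fix e :: real assume "e > 0"
  then have "\<forall>\<^sub>F k in sequentially. \<epsilon> k < e" using assms(1) by (simp add: order_tendstoD)
  then show "\<forall>\<^sub>F k in sequentially. \<forall>x\<in>S. dist (F k x) (G x) < e"
  proof eventually_elim
    case (elim k)
    then show ?case using le_less_trans[OF assms(2) elim] by (simp add: dist_real_def)
  qed
qed

lemma has_real_derivative_limit_of_rate:
  fixes F :: "nat \<Rightarrow> real \<Rightarrow> real"
  assumes S: "convex S" and eps: "\<epsilon> \<longlonglongrightarrow> 0"
    and d: "\<And>k x. x \<in> S \<Longrightarrow> (F k has_real_derivative F' k x) (at x within S)"
    and F': "\<And>k x. x \<in> S \<Longrightarrow> \<bar>F' k x - G' x\<bar> \<le> \<epsilon> k"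
    and F: "\<And>k x. x \<in> S \<Longrightarrow> \<bar>F k x - G x\<bar> \<le> \<epsilon> k"
    and x: "x \<in> S"
  shows "(G has_real_derivative G' x) (at x within S)"
proof -
  have lim: "(\<lambda>k. F k y) \<longlonglongrightarrow> G y" if "y \<in> S" for y
    using tendsto_uniform_limitI[OF uniform_limit_of_rate[OF eps F] that] .
  have "\<exists>g. \<forall>x\<in>S. (\<lambda>n. F n x) \<longlonglongrightarrow> g x \<and> (g has_derivative (*) (G' x)) (at x within S)"
  proof (rule has_derivative_sequence[where f = F and f' = "\<lambda>n x. (*) (F' n x)", OF S _ _ x lim[OF x]])
    show "(F n has_derivative (*) (F' n x)) (at x within S)" if "x \<in> S" for n x
      using d[OF that] by (simp add: has_field_derivative_def)
    fix e :: real assume "e > 0"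
    then have "\<forall>\<^sub>F k in sequentially. \<epsilon> k < e" using eps by (simp add: order_tendstoD)
    then show "\<forall>\<^sub>F n in sequentially. \<forall>x\<in>S. \<forall>h. norm (F' n x * h - G' x * h) \<le> e * norm h"
    proof eventually_elim
      case (elim n)
      have "norm (F' n x * h - G' x * h) \<le> e * norm h" if "x \<in> S" for x h
      proof -
        have "norm (F' n x * h - G' x * h) = \<bar>F' n x - G' x\<bar> * norm h"
          by (simp add: abs_mult flip: left_diff_distrib)
        also have "\<dots> \<le> e * norm h" using F'[OF that, of n] elim by (intro mult_right_mono) auto
        finally show ?thesis .
      qed
      then show ?case by blast
    qed
  qed
  then obtain g where g: "\<And>y. y \<in> S \<Longrightarrow> (\<lambda>n. F n y) \<longlonglongrightarrow> g y"
    "(g has_derivative (*) (G' x)) (at x within S)" using x by blast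
  have "(G has_derivative (*) (G' x)) (at x within S)"
    by (rule has_derivative_transform[OF x _ g(2)]) (use LIMSEQ_unique[OF lim g(1)] in auto)
  then show ?thesis by (simp add: has_field_derivative_def)
qed

lemma has_deriv_within:
  assumes "f differentiable_on S" "x \<in> S"
  shows "(f has_real_derivative deriv_within S f x) (at x within S)"
  using assms unfolding deriv_within_def differentiable_on_def has_real_derivative_iff_has_vector_derivative
  by (simp add: vector_derivative_works)

lemma deriv_within_atLeast_eqI:
  assumes "(f has_real_derivative d) (at x within {a..})" "x \<in> {a..}"
  shows "deriv_within {a..} f x = d"
proof -
  have "at x within {a..} \<noteq> bot"
  proof -
    have "x islimpt {x<..<x+1}" by (rule islimpt_greaterThanLessThan1) simp
    then have "x islimpt {a..}" by (rule islimpt_subset) (use assms(2) in auto)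
    then show ?thesis by (simp add: trivial_limit_within)
  qed
  then show ?thesis using assms unfolding deriv_within_def
    by (intro vector_derivative_within) (auto simp: has_real_derivative_iff_has_vector_derivative)
qed

lemma heat_solution_imp_heat_flow:
  assumes "heat_solution f v"
  shows "heat_flow v (\<lambda>x t. deriv_within {0..1} (\<lambda>\<xi>. v \<xi> t) x) (\<lambda>x t. dt v x t)"
  unfolding heat_flow_def
proof (intro conjI ballI allI impI)
  fix x t :: real assume x: "x \<in> {0<..<1}" and t: "t > 0"
  \<comment> \<open>At interior points the derivatives within the domain are two-sided derivatives.\<close>
  have at: "at t within {0..} = at t" "at x within {0..1} = at x"
    using x t by (auto intro!: at_within_interior)
  have x': "x \<in> {0..1}" using x by auto
  have "(\<lambda>\<tau>. v x \<tau>) differentiable_on {0..}" using assms x' unfolding heat_solution_def by blast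
  from has_deriv_within[OF this, of t] show "(v x has_real_derivative dt v x t) (at t)"
    using t at by simp
  have "(\<lambda>\<xi>. v \<xi> t) twice_differentiable_on {0..1}" using assms t unfolding heat_solution_def by simp
  then have "(\<lambda>\<xi>. v \<xi> t) differentiable_on {0..1}" "deriv_within {0..1} (\<lambda>\<xi>. v \<xi> t) differentiable_on {0..1}"
    by (auto simp: twice_differentiable_on_def)
  from this[THEN has_deriv_within, OF x']
  show "((\<lambda>\<xi>. v \<xi> t) has_real_derivative deriv_within {0..1} (\<lambda>\<xi>. v \<xi> t) x) (at x)"
    and "((\<lambda>\<xi>. deriv_within {0..1} (\<lambda>\<xi>. v \<xi> t) \<xi>) has_real_derivative dt v x t) (at x)"
    using assms x t unfolding at heat_solution_def by auto
qed (use assms in \<open>auto simp: heat_solution_def\<close>)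

lemma heat_solution_unique:
  assumes "heat_solution f v" "heat_solution f w" "x \<in> {0..1}" "t \<ge> 0"
  shows "v x t = w x t"
proof -
  have "\<bar>v x t - w x t\<bar> \<le> 0"
    by (rule heat_flow_difference_bound[OF assms(1,2)[THEN heat_solution_imp_heat_flow] _ assms(3,4)])
      (use assms in \<open>auto simp: heat_solution_def\<close>)
  then show ?thesis by simp
qed

section \<open>Existence and the sine series of the solution\<close>

lemma has_integral_cos_integer:
  fixes i :: int
  shows "((\<lambda>y. cos (of_int i * pi * y)) has_integral (if i = 0 then 1 else 0)) {0..1::real}"
proof (cases "i = 0")
  case True
  then show ?thesis using has_integral_const_real[of "1::real" 0 1] by simp
next
  case False
  have "((\<lambda>y. cos (of_int i * pi * y)) has_integral
      (sin (of_int i * pi * 1) / (of_int i * pi) - sin (of_int i * pi * 0) / (of_int i * pi))) {0..1::real}"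
    by (rule fundamental_theorem_of_calculus)
      (use False in \<open>auto simp flip: has_real_derivative_iff_has_vector_derivative intro!: derivative_eq_intros\<close>)
  moreover have "sin (of_int i * pi) = 0" by (simp add: sin_times_pi_eq_0)
  ultimately show ?thesis using False by simp
qed

lemma sine_orthogonality:
  fixes m n :: nat
  shows "((\<lambda>y. sin (real m * pi * y) * sin (real n * pi * y)) has_integral
    (if m = n \<and> n \<noteq> 0 then 1 / 2 else 0)) {0..1}"
proof -
  have "((\<lambda>y. (cos (of_int (int m - int n) * pi * y) - cos (of_int (int m + int n) * pi * y)) / 2) has_integral
      ((if int m - int n = 0 then 1 else 0) - (if int m + int n = 0 then 1 else 0)) / 2) {0..1::real}"
    by (intro has_integral_divide has_integral_diff has_integral_cos_integer)
  then show ?thesis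
    by (rule has_integral_eq_rhs[OF has_integral_eq, rotated])
      (auto simp: sin_times_sin left_diff_distrib distrib_right)
qed

text \<open>The second derivative \<open>f\<^sub>2\<close> vanishes at both ends, so it is a uniform limit of sine polynomials. Let \<open>w k\<close> be their
heat evolutions and \<open>v k\<close> the evolutions with second space derivative \<open>w k\<close>. The maximum principle makes \<open>w k\<close>
uniformly Cauchy on \<open>[0,1] \<times> [0,\<infinity>)\<close>, including \<open>t = 0\<close>; hence so are \<open>v k\<close> and its first space derivative \<open>d k\<close>. The
limit \<open>u\<close> is a solution all of whose required derivatives are continuous up to \<open>t = 0\<close>. The Fourier series
alone would not give this, because the series for \<open>f\<^sub>2\<close> need not converge uniformly.

The series for \<open>u\<close> is also obtained from the approximations, by Tannery's theorem: the coefficients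
of \<open>v k\<close> are \<open>O(1/n\<^sup>2)\<close> uniformly in \<open>k\<close>. For \<open>t = 0\<close> it shows that \<open>f\<close> is the sum of its sine series.\<close>
lemma heat_solution_exists:
  fixes f f\<^sub>1 f\<^sub>2 :: "real \<Rightarrow> real"
  assumes f1: "\<And>x. x \<in> {0..1} \<Longrightarrow> (f has_real_derivative f\<^sub>1 x) (at x within {0..1})"
    and f2: "\<And>x. x \<in> {0..1} \<Longrightarrow> (f\<^sub>1 has_real_derivative f\<^sub>2 x) (at x within {0..1})"
    and cont: "continuous_on {0..1} f\<^sub>2"
    and f_ends: "f 0 = 0" "f 1 = 0" and f2_ends: "f\<^sub>2 0 = 0" "f\<^sub>2 1 = 0"
  obtains u \<beta> where "bounded_heat_solution f u" "summable (\<lambda>n. \<bar>\<beta> n\<bar>)"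
    "\<And>x t. x \<in> {0..1} \<Longrightarrow> t \<ge> 0 \<Longrightarrow>
      (\<lambda>n. \<beta> n * exp (- ((real n * pi)^2) * t) * sin (real n * pi * x)) sums u x t"
proof -
  define \<epsilon> :: "nat \<Rightarrow> real" where "\<epsilon> k = inverse (real (Suc k))" for k
  have eps: "\<epsilon> \<longlonglongrightarrow> 0" unfolding \<epsilon>_def by (rule LIMSEQ_inverse_real_of_nat)
  have eps1: "\<epsilon> k \<le> 1" "\<epsilon> k > 0" for k by (simp_all add: \<epsilon>_def field_simps)
  have "\<exists>M b. \<forall>x\<in>{0..1}. \<bar>f\<^sub>2 x - (\<Sum>n\<le>M. b n * sin (real n * pi * x))\<bar> < \<epsilon> k" for k
    using sine_polynomial_approximation[OF cont f2_ends eps1(2)[of k]]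
    unfolding sine_polynomial_def by metis
  then obtain N a where Na: "\<And>k x. x \<in> {0..1} \<Longrightarrow> \<bar>f\<^sub>2 x - (\<Sum>n\<le>N k. a k n * sin (real n * pi * x))\<bar> < \<epsilon> k"
    by metis
  define b where "b k n = - a k n / (real n * pi)^2" for k n
  define w where "w k = sine_evolution (a k) (N k)" for k
  define v where "v k = sine_evolution (b k) (N k)" for k
  define d where "d k = sine_evolution_dx (b k) (N k)" for k
  have lap: "sine_evolution (\<lambda>n. - ((real n * pi)^2) * b k n) (N k) = w k" for k
    unfolding w_def b_def by (rule sine_evolution_antiderivative)
  have v_dt: "(v k x has_real_derivative w k x t) (at t within S)" for k x t S
    using sine_evolution_has_dt[of "b k" "N k"] unfolding lap by (simp add: v_def)
  have v_dx: "((\<lambda>x. v k x t) has_real_derivative d k x t) (at x within S)" for k x t S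
    unfolding v_def d_def by (rule sine_evolution_has_dx)
  have d_dx: "((\<lambda>x. d k x t) has_real_derivative w k x t) (at x within S)" for k x t S
    using sine_evolution_dx_has_dx[of "b k" "N k"] unfolding lap by (simp add: d_def)
  have v_ends: "v k 0 t = 0" "v k 1 t = 0" for k t
    by (simp_all add: v_def sine_evolution_boundary)
  have w0: "w k x 0 = (\<Sum>n\<le>N k. a k n * sin (real n * pi * x))" for k x
    by (simp add: w_def sine_evolution_def)
  have w_init: "\<bar>w k x 0 - f\<^sub>2 x\<bar> \<le> \<epsilon> k" if "x \<in> {0..1}" for k x
    using Na[OF that, of k] unfolding w0 by linarith
  have w_rate: "\<bar>w k x t - w j x t\<bar> \<le> \<epsilon> k + \<epsilon> j" if x: "x \<in> {0..1}" and t: "t \<ge> 0" for k j x t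
    unfolding w_def
  proof (rule heat_flow_difference_bound[OF sine_evolution_heat_flow sine_evolution_heat_flow _ x t], fold w_def)
    fix y :: real assume "y \<in> {0..1}"
    from w_init[OF this, of k] w_init[OF this, of j] show "\<bar>w k y 0 - w j y 0\<bar> \<le> \<epsilon> k + \<epsilon> j" by linarith
  qed
  have d_rate: "\<bar>d k x t - d j x t\<bar> \<le> \<epsilon> k + \<epsilon> j" and v_rate: "\<bar>v k x t - v j x t\<bar> \<le> \<epsilon> k + \<epsilon> j"
    if x: "x \<in> {0..1}" and t: "t \<ge> 0" for k j x t
    using bounds_from_second_derivative[where h = "\<lambda>x. v k x t - v j x t" and h' = "\<lambda>x. d k x t - d j x t"
        and h'' = "\<lambda>x. w k x t - w j x t", OF DERIV_diff[OF v_dx v_dx] DERIV_diff[OF d_dx d_dx] _ _ w_rate[OF _ t] x]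
    by (simp_all add: v_ends)
  have v_init: "\<bar>v k x 0 - f x\<bar> \<le> \<epsilon> k" if x: "x \<in> {0..1}" for k x
    using bounds_from_second_derivative(2)[where h = "\<lambda>x. v k x 0 - f x" and h' = "\<lambda>x. d k x 0 - f\<^sub>1 x"
        and h'' = "\<lambda>x. w k x 0 - f\<^sub>2 x", OF DERIV_diff[OF v_dx f1] DERIV_diff[OF d_dx f2] _ _ w_init x]
    by (simp add: v_ends f_ends)
  define u where "u x t = lim (\<lambda>k. v k x t)" for x t
  define D where "D x t = lim (\<lambda>k. d k x t)" for x t
  define W where "W x t = lim (\<lambda>k. w k x t)" for x t
  have v_lim: "(\<lambda>k. v k x t) \<longlonglongrightarrow> u x t" and v_err: "\<bar>v k x t - u x t\<bar> \<le> \<epsilon> k"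
    and d_err: "\<bar>d k x t - D x t\<bar> \<le> \<epsilon> k" and w_err: "\<bar>w k x t - W x t\<bar> \<le> \<epsilon> k"
    if "x \<in> {0..1}" "t \<ge> 0" for k x t
    using Cauchy_with_rate[OF eps, of "\<lambda>k. v k x t"] Cauchy_with_rate[OF eps, of "\<lambda>k. d k x t"]
      Cauchy_with_rate[OF eps, of "\<lambda>k. w k x t"] v_rate[OF that] d_rate[OF that] w_rate[OF that]
    by (simp_all add: u_def D_def W_def)
  have u_cont: "continuous_on ({0..1} \<times> {0..}) (\<lambda>(x, t). u x t)"
    by (rule uniform_limit_theorem[OF always_eventually uniform_limit_of_rate[OF eps, of _ "\<lambda>k (x, t). v k x t"]])
      (use v_err in \<open>auto simp: v_def sine_evolution_continuous\<close>)
  have W_cont: "continuous_on ({0..1} \<times> {0..}) (\<lambda>(x, t). W x t)"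
    by (rule uniform_limit_theorem[OF always_eventually uniform_limit_of_rate[OF eps, of _ "\<lambda>k (x, t). w k x t"]])
      (use w_err in \<open>auto simp: w_def sine_evolution_continuous\<close>)
  have u_dt: "(u x has_real_derivative W x t) (at t within {0..})" if "x \<in> {0..1}" "t \<ge> 0" for x t
    by (rule has_real_derivative_limit_of_rate[OF _ eps, where F = "\<lambda>k. v k x" and F' = "\<lambda>k. w k x"])
      (use that v_dt v_err w_err in auto)
  have u_dx: "((\<lambda>x. u x t) has_real_derivative D x t) (at x within {0..1})" if "x \<in> {0..1}" "t \<ge> 0" for x t
    by (rule has_real_derivative_limit_of_rate[OF _ eps, where F = "\<lambda>k x. v k x t" and F' = "\<lambda>k x. d k x t"])
      (use that v_dx v_err d_err in auto)
  have D_dx: "((\<lambda>x. D x t) has_real_derivative W x t) (at x within {0..1})" if "x \<in> {0..1}" "t \<ge> 0" for x t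
    by (rule has_real_derivative_limit_of_rate[OF _ eps, where F = "\<lambda>k x. d k x t" and F' = "\<lambda>k x. w k x t"])
      (use that d_dx d_err w_err in auto)
  have dt_eq: "dt u x t = W x t" if "x \<in> {0..1}" "t \<ge> 0" for x t
    using u_dt[OF that] that by (intro deriv_within_atLeast_eqI) auto
  have dx_eq: "deriv_within {0..1} (\<lambda>\<xi>. u \<xi> t) x = D x t" if "x \<in> {0..1}" "t \<ge> 0" for x t
    using u_dx[OF that] that by (intro deriv_within_eqI) auto
  have ux_dx: "(deriv_within {0..1} (\<lambda>\<xi>. u \<xi> t) has_real_derivative W x t) (at x within {0..1})"
    if "x \<in> {0..1}" "t \<ge> 0" for x t
    using D_dx[OF that] unfolding has_field_derivative_def
    by (rule has_derivative_transform[rotated 2]) (use that dx_eq in auto)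
  have dxx_eq: "dxx u x t = W x t" if "x \<in> {0..1}" "t \<ge> 0" for x t
    using ux_dx[OF that] that by (intro deriv_within_eqI) auto
  have u_init: "u x 0 = f x" if x: "x \<in> {0..1}" for x
  proof -
    have "(\<lambda>k. v k x 0) \<longlonglongrightarrow> f x"
      using tendsto_uniform_limitI[OF uniform_limit_of_rate[OF eps, of "{0..1}" "\<lambda>k x. v k x 0"] x] v_init by auto
    with v_lim[OF x, of 0] show ?thesis by (auto intro: LIMSEQ_unique)
  qed
  have "heat_solution f u"
    unfolding heat_solution_def
  proof (intro conjI ballI allI impI)
    show "continuous_on ({0..1} \<times> {0..}) (\<lambda>(x, t). dt u x t)"
      using W_cont by (rule continuous_on_eq) (auto simp: dt_eq)
    show "continuous_on ({0..1} \<times> {0..}) (\<lambda>(x, t). dxx u x t)"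
      using W_cont by (rule continuous_on_eq) (auto simp: dxx_eq)
    show "u x differentiable_on {0..}" if "x \<in> {0..1}" for x
      using u_dt[OF that] by (auto simp: differentiable_on_def real_differentiable_def)
    show "(\<lambda>\<xi>. u \<xi> t) twice_differentiable_on {0..1}" if "t \<ge> 0" for t
      using u_dx[OF _ that] ux_dx[OF _ that]
      unfolding twice_differentiable_on_def differentiable_on_def real_differentiable_def by blast
    show "u 0 t = 0" "u 1 t = 0" if "t > 0" for t by (simp_all add: u_def v_ends)
  qed (use u_cont u_init dt_eq dxx_eq in auto)

  have f2_bd: "bounded (f\<^sub>2 ` {0..1})" using cont by (intro compact_imp_bounded compact_continuous_image) auto
  then obtain B where "\<forall>z\<in>f\<^sub>2 ` {0..1}. norm z \<le> B" unfolding bounded_iff by blast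
  then have B: "\<bar>f\<^sub>2 x\<bar> \<le> B" if "x \<in> {0..1}" for x using that by simp
  \<comment> \<open>By orthogonality \<open>\<alpha> k n\<close> recovers the coefficients of the \<open>k\<close>-th sine polynomial, extended by \<open>0\<close>.\<close>
  define \<alpha> where "\<alpha> k n = 2 * integral {0..1} (\<lambda>y. w k y 0 * sin (real n * pi * y))" for k n
  define \<alpha>' where "\<alpha>' n = 2 * integral {0..1} (\<lambda>y. f\<^sub>2 y * sin (real n * pi * y))" for n
  have w_cont: "continuous_on {0..1} (\<lambda>y. w k y 0)" for k
    unfolding w0 by (intro continuous_intros)
  have int_bound: "\<bar>integral {0..1} (\<lambda>y. h y * sin (real n * pi * y))\<bar> \<le> C"
    if h: "continuous_on {0..1} h" and C: "\<And>y. y \<in> {0..1} \<Longrightarrow> \<bar>h y\<bar> \<le> C" for h C n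
  proof -
    have "norm (integral {0..1} (\<lambda>y. h y * sin (real n * pi * y))) \<le> C * (1 - 0)"
    proof (rule integral_bound)
      show "continuous_on {0..1} (\<lambda>y. h y * sin (real n * pi * y))" by (intro continuous_intros h)
      fix y :: real assume y: "y \<in> {0..1}"
      have "\<bar>h y\<bar> * \<bar>sin (real n * pi * y)\<bar> \<le> C * 1"
        using C[OF y] by (intro mult_mono) auto
      then show "norm (h y * sin (real n * pi * y)) \<le> C" by (simp add: abs_mult)
    qed simp
    then show ?thesis by simp
  qed
  have \<alpha>_bound: "\<bar>\<alpha> k n\<bar> \<le> 2 * (B + 1)" for k n
  proof -
    have "\<bar>w k y 0\<bar> \<le> B + 1" if "y \<in> {0..1}" for y
      using w_init[OF that, of k] B[OF that] eps1(1)[of k] by linarith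
    from int_bound[OF w_cont this, of n] show ?thesis by (simp add: \<alpha>_def abs_mult)
  qed
  have \<alpha>_lim: "(\<lambda>k. \<alpha> k n) \<longlonglongrightarrow> \<alpha>' n" for n
  proof -
    have err: "\<bar>\<alpha> k n - \<alpha>' n\<bar> \<le> 2 * \<epsilon> k" for k
    proof -
      have "integral {0..1} (\<lambda>y. w k y 0 * sin (real n * pi * y)) - integral {0..1} (\<lambda>y. f\<^sub>2 y * sin (real n * pi * y))
          = integral {0..1} (\<lambda>y. (w k y 0 - f\<^sub>2 y) * sin (real n * pi * y))"
        unfolding left_diff_distrib
        by (rule integral_diff[symmetric]) (intro integrable_continuous_interval continuous_intros w_cont cont)+
      moreover have "\<bar>integral {0..1} (\<lambda>y. (w k y 0 - f\<^sub>2 y) * sin (real n * pi * y))\<bar> \<le> \<epsilon> k"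
        by (rule int_bound[OF continuous_on_diff[OF w_cont cont] w_init])
      ultimately show ?thesis unfolding \<alpha>_def \<alpha>'_def by linarith
    qed
    have "(\<lambda>k. \<alpha> k n - \<alpha>' n) \<longlonglongrightarrow> 0"
    proof (rule Lim_null_comparison)
      show "\<forall>\<^sub>F k in sequentially. norm (\<alpha> k n - \<alpha>' n) \<le> 2 * \<epsilon> k" using err by simp
      show "(\<lambda>k. 2 * \<epsilon> k) \<longlonglongrightarrow> 0" by (rule tendsto_mult_right_zero[OF eps])
    qed
    then show ?thesis by (rule LIM_zero_cancel)
  qed
  have \<alpha>_eq: "\<alpha> k n = (if n \<le> N k \<and> n \<noteq> 0 then a k n else 0)" for k n
  proof -
    have "((\<lambda>y. \<Sum>m\<le>N k. a k m * (sin (real m * pi * y) * sin (real n * pi * y))) has_integral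
        (\<Sum>m\<le>N k. a k m * (if m = n \<and> n \<noteq> 0 then 1 / 2 else 0))) {0..1}"
      by (intro has_integral_sum has_integral_mult_right sine_orthogonality) simp
    also have "(\<Sum>m\<le>N k. a k m * (if m = n \<and> n \<noteq> 0 then 1 / 2 else 0)) = (\<Sum>m\<le>N k. if m = n then (if n \<noteq> 0 then a k n / 2 else 0) else 0)"
      by (intro sum.cong) auto
    also have "\<dots> = (if n \<le> N k \<and> n \<noteq> 0 then a k n / 2 else 0)" by simp
    finally have I: "((\<lambda>y. \<Sum>m\<le>N k. a k m * (sin (real m * pi * y) * sin (real n * pi * y))) has_integral
        (if n \<le> N k \<and> n \<noteq> 0 then a k n / 2 else 0)) {0..1}" .
    have "w k y 0 * sin (real n * pi * y) = (\<Sum>m\<le>N k. a k m * (sin (real m * pi * y) * sin (real n * pi * y)))" for y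
      unfolding w0 sum_distrib_right by (rule sum.cong) simp_all
    then show ?thesis unfolding \<alpha>_def by (simp only: integral_unique[OF I]) simp
  qed
  define \<beta> where "\<beta> n = - \<alpha>' n / (real n * pi)^2" for n
  define C where "C n = 2 * (B + 1) / pi^2 * inverse (real n ^ 2)" for n
  have C_sum: "summable C" unfolding C_def
    by (intro summable_mult inverse_power_summable) simp
  have C_bound: "\<bar>A / (real n * pi)^2\<bar> \<le> C n" if "\<bar>A\<bar> \<le> 2 * (B + 1)" for A n
  proof -
    have "\<bar>A / (real n * pi)^2\<bar> = \<bar>A\<bar> / (real n * pi)^2" by simp
    also have "\<dots> \<le> 2 * (B + 1) / (real n * pi)^2" by (rule divide_right_mono[OF that]) simp
    also have "\<dots> = C n" by (simp add: C_def power_mult_distrib divide_inverse mult_ac)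
    finally show ?thesis .
  qed
  have "\<bar>\<alpha>' n\<bar> \<le> 2 * (B + 1)" for n
    using int_bound[OF cont B, of n] by (simp add: \<alpha>'_def abs_mult)
  then have \<beta>_bound: "\<bar>\<beta> n\<bar> \<le> C n" for n using C_bound[of "- \<alpha>' n" n] by (simp add: \<beta>_def)
  have \<beta>_sum: "summable (\<lambda>n. \<bar>\<beta> n\<bar>)"
    by (rule summable_comparison_test[OF _ C_sum]) (use \<beta>_bound in auto)
  have sums: "(\<lambda>n. \<beta> n * exp (- ((real n * pi)^2) * t) * sin (real n * pi * x)) sums u x t"
    if x: "x \<in> {0..1}" and t: "t \<ge> 0" for x t
  proof -
    define T where "T A n = - A / (real n * pi)^2 * exp (- ((real n * pi)^2) * t) * sin (real n * pi * x)" for A n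
    have T_bound: "norm (T A n) \<le> C n" if "\<bar>A\<bar> \<le> 2 * (B + 1)" for A n
    proof -
      have "norm (T A n) = \<bar>- A / (real n * pi)^2\<bar> * \<bar>exp (- ((real n * pi)^2) * t)\<bar> * \<bar>sin (real n * pi * x)\<bar>"
        unfolding T_def by (simp only: real_norm_def abs_mult)
      also have "\<dots> \<le> C n * 1 * 1"
        using C_bound[of "- A" n] that t order_trans[OF abs_ge_zero C_bound[of "- A" n]]
        by (intro mult_mono) auto
      finally show ?thesis by simp
    qed
    have v_eq: "v k x t = (\<Sum>n. T (\<alpha> k n) n)" for k
    proof -
      have "(\<Sum>n. T (\<alpha> k n) n) = (\<Sum>n\<le>N k. T (\<alpha> k n) n)"
        by (rule suminf_finite) (auto simp: T_def \<alpha>_eq)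
      also have "\<dots> = v k x t"
        unfolding v_def sine_evolution_def by (intro sum.cong) (auto simp: T_def \<alpha>_eq b_def)
      finally show ?thesis by simp
    qed
    have tan: "summable (\<lambda>n. norm (T (\<alpha>' n) n)) \<and> (\<lambda>k. \<Sum>n. T (\<alpha> k n) n) \<longlonglongrightarrow> (\<Sum>n. T (\<alpha>' n) n)"
    proof (rule conjunct2[OF tannerys_theorem[where a = "\<lambda>n k. T (\<alpha> k n) n" and b = "\<lambda>n. T (\<alpha>' n) n", OF _ _ C_sum]])
      show "(\<lambda>k. T (\<alpha> k n) n) \<longlonglongrightarrow> T (\<alpha>' n) n" for n
        unfolding T_def by (cases "n = 0") (auto intro!: tendsto_intros \<alpha>_lim)
      show "\<forall>\<^sub>F (n, k) in at_top \<times>\<^sub>F sequentially. norm (T (\<alpha> k n) n) \<le> C n"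
        by (intro always_eventually) (use T_bound \<alpha>_bound in auto)
    qed simp
    then have "u x t = (\<Sum>n. T (\<alpha>' n) n)"
      using v_lim[OF x t] unfolding v_eq by (auto intro: LIMSEQ_unique)
    moreover have "(\<lambda>n. T (\<alpha>' n) n) sums (\<Sum>n. T (\<alpha>' n) n)"
      by (rule summable_sums[OF summable_norm_cancel[OF conjunct1[OF tan]]])
    ultimately show ?thesis by (simp add: T_def \<beta>_def)
  qed
  have "bounded ((\<lambda>(x, t). u x t) ` ({0..1} \<times> {0..}))"
  proof -
    have "\<bar>u x t\<bar> \<le> (\<Sum>n. \<bar>\<beta> n\<bar>)" if x: "x \<in> {0..1}" and t: "t \<ge> 0" for x t
    proof -
      have "\<bar>\<beta> n * exp (- ((real n * pi)^2) * t) * sin (real n * pi * x)\<bar> \<le> \<bar>\<beta> n\<bar> * 1 * 1" for n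
        unfolding abs_mult using t by (intro mult_mono) auto
      then show ?thesis
        using norm_suminf_le[OF _ \<beta>_sum, of "\<lambda>n. \<beta> n * exp (- ((real n * pi)^2) * t) * sin (real n * pi * x)"]
          sums_unique[OF sums[OF x t]] by simp
    qed
    then show ?thesis by (intro boundedI[of _ "\<Sum>n. \<bar>\<beta> n\<bar>"]) auto
  qed
  with \<open>heat_solution f u\<close> have "bounded_heat_solution f u" by (simp add: bounded_heat_solution_def)
  then show thesis using \<beta>_sum sums by (rule that)
qed

section \<open>Fourier inversion of a single mode\<close>

lemma integral_inverse_sum_squares:
  fixes a M :: real
  assumes "a > 0" "M \<ge> 0"
  shows "((\<lambda>s. 1 / (s^2 + a^2)) has_integral (2 / a * arctan (M / a))) {-M..M}"
proof -
  have "((\<lambda>s. 1 / (s^2 + a^2)) has_integral (arctan (M / a) / a - arctan (- M / a) / a)) {-M..M}"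
  proof (rule fundamental_theorem_of_calculus)
    fix s assume "s \<in> {-M..M}"
    have "a * (a * (a * a)) + a * (a * (s * s)) > 0"
      using assms by (simp add: add_pos_nonneg)
    then have "((\<lambda>s. arctan (s / a) / a) has_real_derivative 1 / (s^2 + a^2)) (at s within {-M..M})"
      using assms by (auto intro!: derivative_eq_intros simp: field_simps power2_eq_square)
    then show "((\<lambda>s. arctan (s / a) / a) has_vector_derivative 1 / (s^2 + a^2)) (at s within {-M..M})"
      by (simp add: has_real_derivative_iff_has_vector_derivative)
  qed (use assms in auto)
  then show ?thesis using arctan_minus[of "M/a"] by (simp add: field_simps)
qed

lemma norm_imaginary_plus_real_sq:
  fixes a s :: real
  shows "(norm (\<i> * of_real s + of_real a))^2 = s^2 + a^2"
  by (simp add: cmod_power2)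

text \<open>Integrating by parts once, with \<open>e\<^bsup>ist\<^esup>\<close> as the integrated factor, trades the conditionally
convergent kernel \<open>1/(is + a)\<close> for the absolutely integrable \<open>1/(is + a)\<^sup>2\<close>. The resulting bound is uniform in
\<open>M\<close> and decreases in \<open>a\<close>; this uniformity is what later allows the limit \<open>M \<rightarrow> \<infinity>\<close> to be taken term by term
in a series over the modes.\<close>
lemma mode_integral_bound:
  fixes a t M :: real
  assumes a: "a > 0" and t: "t > 0" and M: "M \<ge> 0"
  shows "norm (integral {-M..M} (\<lambda>s. exp (\<i> * of_real s * of_real t) / (\<i> * of_real s + of_real a)))
     \<le> (2 + pi) / (t * a)"
proof -
  define D :: "real \<Rightarrow> complex" where "D s = \<i> * of_real s + of_real a" for s
  define e :: "real \<Rightarrow> complex" where "e s = exp (\<i> * of_real s * of_real t)" for s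
  \<comment> \<open>The primitive produced by integration by parts; both boundary terms are at most \<open>1/(ta)\<close>.\<close>
  define F where "F s = e s / (\<i> * of_real t * D s)" for s
  have D0: "D s \<noteq> 0" for s using a by (auto simp: D_def complex_eq_iff)
  have ne: "norm (e s) = 1" for s
    unfolding e_def by (metis mult.assoc mult.commute norm_exp_i_times of_real_mult)
  have Da: "norm (D s) \<ge> a" for s
    using a abs_Re_le_cmod[of "D s"] by (simp add: D_def)
  have contD: "continuous_on X D" and conte: "continuous_on X e" for X
    unfolding D_def e_def by (intro continuous_intros)+
  have dF: "((\<lambda>s. F s) has_vector_derivative (e s / D s - e s / (of_real t * (D s)^2))) (at s within X)" for s X
  proof -
    define G :: "complex \<Rightarrow> complex" where "G z = exp (\<i> * z * of_real t) / (\<i> * of_real t * (\<i> * z + of_real a))" for z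
    have "\<i> * of_real s + of_real a \<noteq> 0" using D0[of s] by (simp add: D_def)
    then have "(G has_field_derivative ((e s * (\<i> * of_real t)) * (\<i> * of_real t * D s) - e s * (\<i> * of_real t * \<i>))
        / ((\<i> * of_real t * D s) * (\<i> * of_real t * D s))) (at (of_real s))"
      unfolding G_def e_def D_def using t by (auto intro!: derivative_eq_intros simp: mult_ac)
    also have "((e s * (\<i> * of_real t)) * (\<i> * of_real t * D s) - e s * (\<i> * of_real t * \<i>))
        / ((\<i> * of_real t * D s) * (\<i> * of_real t * D s)) = e s / D s - e s / (of_real t * (D s)^2)"
      using D0[of s] t by (simp add: field_simps power2_eq_square)
    finally have "(G has_field_derivative (e s / D s - e s / (of_real t * (D s)^2))) (at (of_real s))" .
    from has_vector_derivative_real_field[OF this] show ?thesis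
      by (simp add: F_def G_def e_def D_def)
  qed
  have hI: "((\<lambda>s. e s / D s - e s / (of_real t * (D s)^2)) has_integral (F M - F (-M))) {-M..M}"
    by (rule fundamental_theorem_of_calculus) (use M dF in auto)
  have int2: "(\<lambda>s. e s / (of_real t * (D s)^2)) integrable_on {-M..M}"
    by (intro integrable_continuous_interval continuous_intros contD conte) (use D0 t in auto)
  have sq: "(norm (D s))^2 = s^2 + a^2" for s
    by (simp add: D_def norm_imaginary_plus_real_sq)
  have b2: "norm (integral {-M..M} (\<lambda>s. e s / (of_real t * (D s)^2))) \<le> pi / (t * a)"
  proof -
    have h: "((\<lambda>s. (1/t) * (1 / (s^2 + a^2))) has_integral ((1/t) * (2 / a * arctan (M / a)))) {-M..M}"
      by (rule has_integral_mult_right[OF integral_inverse_sum_squares[OF a M]])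
    have "norm (integral {-M..M} (\<lambda>s. e s / (of_real t * (D s)^2))) \<le> integral {-M..M} (\<lambda>s. (1/t) * (1 / (s^2 + a^2)))"
      by (rule integral_norm_bound_integral[OF int2])
        (use h t in \<open>auto simp: norm_divide norm_mult norm_power sq ne field_simps\<close>)
    also have "\<dots> = (1/t) * (2 / a * arctan (M / a))"
      using h by (rule integral_unique)
    also have "\<dots> \<le> (1/t) * (2 / a * (pi/2))"
      using arctan_ubound[of "M/a"] a t by (intro mult_left_mono) auto
    finally show ?thesis using a t by (simp add: field_simps)
  qed
  have bF: "norm (F s) \<le> 1 / (t * a)" for s
    using Da[of s] a t unfolding F_def norm_divide norm_mult ne
    by (auto intro!: divide_left_mono mult_pos_pos)
  have "integral {-M..M} (\<lambda>s. e s / D s) = (F M - F (-M)) + integral {-M..M} (\<lambda>s. e s / (of_real t * (D s)^2))"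
    using has_integral_add[OF hI integrable_integral[OF int2]] by (simp add: integral_unique)
  also have "norm \<dots> \<le> (1 / (t * a) + 1 / (t * a)) + pi / (t * a)"
    by (intro order_trans[OF norm_triangle_ineq] order_trans[OF norm_triangle_ineq4] add_mono bF b2)
  finally show ?thesis by (simp add: e_def D_def add_divide_distrib mult.commute)
qed

lemma integral_inverse_minus_imaginary:
  fixes a M :: real
  assumes a: "a > 0" and M: "M \<ge> 0"
  shows "((\<lambda>s. 1 / (of_real s - \<i> * of_real a)) has_integral (2 * \<i> * of_real (arctan (M / a)))) {-M..M}"
proof -
  define P :: "real \<Rightarrow> complex" where "P s = of_real (ln (s^2 + a^2) / 2) + \<i> * of_real (arctan (s / a))" for s
  have "((\<lambda>s. 1 / (of_real s - \<i> * of_real a)) has_integral (P M - P (-M))) {-M..M}"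
  proof (rule fundamental_theorem_of_calculus)
    fix s assume "s \<in> {-M..M}"
    have pos: "s^2 + a^2 > 0" using a by (simp add: add_nonneg_pos)
    have d1: "((\<lambda>s. ln (s^2 + a^2) / 2) has_real_derivative (s / (s^2 + a^2))) (at s within {-M..M})"
      using pos by (auto intro!: derivative_eq_intros simp: divide_simps)
    have d2: "((\<lambda>s. arctan (s / a)) has_real_derivative (a / (s^2 + a^2))) (at s within {-M..M})"
      using a pos by (auto intro!: derivative_eq_intros simp: field_simps power2_eq_square)
    have "(P has_vector_derivative (of_real (s / (s^2 + a^2)) + \<i> * of_real (a / (s^2 + a^2)))) (at s within {-M..M})"
      unfolding P_def
      by (intro has_vector_derivative_add has_vector_derivative_mult_right
            d1[THEN has_vector_derivative_of_real] d2[THEN has_vector_derivative_of_real])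
    moreover have "of_real (s / (s^2 + a^2)) + \<i> * of_real (a / (s^2 + a^2)) = 1 / (of_real s - \<i> * of_real a)"
      using a by (simp add: complex_eq_iff Re_divide Im_divide power2_eq_square)
    ultimately show "(P has_vector_derivative 1 / (of_real s - \<i> * of_real a)) (at s within {-M..M})"
      by simp
  qed (use M in simp)
  moreover have "P M - P (-M) = 2 * \<i> * of_real (arctan (M / a))"
    by (simp add: P_def arctan_minus)
  ultimately show ?thesis by simp
qed

text \<open>The interval \<open>[-M, M]\<close> is closed up by the upper half circle \<open>\<gamma>\<close> of radius \<open>M\<close>, which encloses the only pole \<open>c = ia\<close> of
\<open>e\<^bsup>izt\<^esup>/(z - c)\<close>. The pole is subtracted: the quotient
\<open>(e\<^bsup>izt\<^esup> - e\<^bsup>ict\<^esup>)/(z - c)\<close> is entire, so its closed contour integral vanishes, and what is left are the integrals of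
\<open>1/(z - c)\<close> over both pieces, each close to \<open>i\<pi>\<close>, and the integral of \<open>e\<^bsup>izt\<^esup>/(z - c)\<close> over \<open>\<gamma>\<close>, which is
small. The error is left explicit, so that the limit only needs elementary asymptotics.\<close>
lemma mode_integral_error:
  fixes a t M :: real
  assumes a: "a > 0" and t: "t > 0" and M: "M > a"
  shows "norm (integral {-M..M} (\<lambda>s. exp (\<i> * of_real s * of_real t) / (\<i> * of_real s + of_real a))
      - of_real (exp (- a * t) * (2 * arctan (M / a) + pi)))
     \<le> a * pi / (M - a) + (2 / (t * (M - a)) + pi * M / (t * (M - a)^2))"
proof -
  define c :: complex where "c = \<i> * of_real a"
  define E :: "complex \<Rightarrow> complex" where "E z = exp (\<i> * z * of_real t)" for z
  define \<gamma> where "\<gamma> = part_circlepath 0 M 0 pi"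
  have M0: "M > 0" using a M by linarith
  have ends: "pathstart \<gamma> = of_real M" "pathfinish \<gamma> = - of_real M"
    by (simp_all add: \<gamma>_def)
  have im\<gamma>: "norm z = M \<and> Im z \<ge> 0" if "z \<in> path_image \<gamma>" for z
  proof -
    from that M0 obtain x where x: "x \<in> {0..pi}" "z = of_real M * exp (\<i> * of_real x)"
      by (auto simp: \<gamma>_def path_image_part_circlepath)
    have "Im z = M * sin x" by (simp add: x flip: cis_conv_exp)
    then show ?thesis using x M0 by (simp add: norm_mult sin_ge_zero)
  qed
  have zc: "norm (z - c) \<ge> M - a" if "z \<in> path_image \<gamma>" for z
    using norm_triangle_ineq2[of z c] im\<gamma>[OF that] a by (simp add: c_def norm_mult)
  have zc0: "z \<noteq> c" if "z \<in> path_image \<gamma>" for z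
    using zc[OF that] M by auto
  have lc0: "of_real s \<noteq> c" for s using a by (auto simp: c_def complex_eq_iff)
  have E1: "norm (E z) \<le> 1" if "Im z \<ge> 0" for z
    using that t by (simp add: E_def)
  have Ec: "E c = of_real (exp (- a * t))"
    by (simp add: E_def c_def exp_of_real flip: of_real_mult of_real_minus)
  have v\<gamma>: "valid_path \<gamma>" by (simp add: \<gamma>_def)
  have contE: "continuous_on X E" for X unfolding E_def by (intro continuous_intros)
  have int\<gamma>: "f contour_integrable_on \<gamma>" if "continuous_on (path_image \<gamma>) f" for f
    using that unfolding \<gamma>_def by (rule contour_integrable_continuous_part_circlepath)
  define q where "q z = (if z = c then deriv E c else (E z - E c) / (z - c))" for z
  have "E holomorphic_on UNIV" unfolding E_def by (intro holomorphic_intros)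
  then have "q holomorphic_on UNIV"
    unfolding q_def by (rule pole_lemma_open) simp
  then have "(q has_contour_integral 0) (linepath (- of_real M) (of_real M) +++ \<gamma>)"
    by (rule Cauchy_theorem_convex_simple) (auto simp: ends v\<gamma> intro!: valid_path_join)
  moreover have qcont: "continuous_on X q" for X
    using \<open>q holomorphic_on UNIV\<close> holomorphic_on_imp_continuous_on continuous_on_subset by blast
  ultimately have q0: "contour_integral (linepath (- of_real M) (of_real M)) q + contour_integral \<gamma> q = 0"
    using contour_integral_join[of q "linepath (- of_real M) (of_real M)" \<gamma>]
      contour_integrable_continuous_linepath[OF qcont] int\<gamma>[OF qcont] v\<gamma>
    by (simp add: contour_integral_unique)
  have "contour_integral (linepath (- of_real M) (of_real M)) q = integral {-M..M} (\<lambda>s. (E (of_real s) - E c) / (of_real s - c))"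
    using contour_integral_linepath_Reals_eq[of "- of_real M" "of_real M" q] M0 lc0 by (simp add: q_def)
  also have "\<dots> = integral {-M..M} (\<lambda>s. E (of_real s) / (of_real s - c)) - E c * integral {-M..M} (\<lambda>s. 1 / (of_real s - c))"
  proof -
    have "(\<lambda>s. E (of_real s) / (of_real s - c)) integrable_on {-M..M}" "(\<lambda>s. E c * (1 / (of_real s - c))) integrable_on {-M..M}"
      unfolding E_def by (intro integrable_continuous_interval continuous_intros; simp add: lc0)+
    from integral_diff[OF this] show ?thesis
      unfolding integral_mult_right by (simp add: diff_divide_distrib)
  qed
  also have "integral {-M..M} (\<lambda>s. 1 / (of_real s - c)) = 2 * \<i> * of_real (arctan (M / a))"
    unfolding c_def using integral_inverse_minus_imaginary[of a M] a M0 by (intro integral_unique) auto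
  finally have line: "contour_integral (linepath (- of_real M) (of_real M)) q = integral {-M..M} (\<lambda>s. E (of_real s) / (of_real s - c)) - E c * (2 * \<i> * of_real (arctan (M / a)))" .
  define A1 where "A1 = contour_integral \<gamma> (\<lambda>z. 1 / (z - c))"
  define A2 where "A2 = contour_integral \<gamma> (\<lambda>z. E z / (z - c))"
  have h1: "((\<lambda>z. 1 / (z - c)) has_contour_integral A1) \<gamma>"
    unfolding A1_def by (intro has_contour_integral_integral int\<gamma> continuous_intros) (auto simp: zc0)
  have h2: "((\<lambda>z. E z / (z - c)) has_contour_integral A2) \<gamma>"
    unfolding A2_def by (intro has_contour_integral_integral int\<gamma> continuous_intros contE) (auto simp: zc0)
  have "((\<lambda>z. E z / (z - c) - E c * (1 / (z - c))) has_contour_integral (A2 - E c * A1)) \<gamma>"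
    by (intro has_contour_integral_diff has_contour_integral_lmul h1 h2)
  then have "(q has_contour_integral (A2 - E c * A1)) \<gamma>"
    by (rule has_contour_integral_eq) (auto simp: q_def zc0 diff_divide_distrib)
  then have arc: "contour_integral \<gamma> q = A2 - E c * A1" by (rule contour_integral_unique)
  \<comment> \<open>Compare with \<open>1/z\<close>, whose integral over the half circle is exactly \<open>i\<pi>\<close>: the integrands differ by a term of order \<open>1/M\<^sup>2\<close>.\<close>
  have A1: "norm (A1 - \<i> * of_real pi) \<le> a * pi / (M - a)"
  proof -
    have z0: "z \<noteq> 0" if "z \<in> path_image \<gamma>" for z using im\<gamma>[OF that] M0 by auto
    have hz: "((\<lambda>z. 1 / z) has_contour_integral (\<i> * of_real pi)) \<gamma>"
      using M0 unfolding \<gamma>_def by (subst has_contour_integral_part_circlepath_iff)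
        (auto simp: has_integral_const_real[of _ 0 pi, simplified] exp_minus field_simps
          scaleR_conv_of_real mult.commute intro!: has_integral_eq_rhs[OF has_integral_const_real])
    have "((\<lambda>z. 1 / (z - c) - 1 / z) has_contour_integral (A1 - \<i> * of_real pi)) \<gamma>"
      by (intro has_contour_integral_diff h1 hz)
    then have "norm (A1 - \<i> * of_real pi) \<le> (a / ((M - a) * M)) * M * (pi - 0)"
      unfolding \<gamma>_def
    proof (rule has_contour_integral_bound_part_circlepath)
      fix z assume "z \<in> path_image (part_circlepath 0 M 0 pi)"
      then have z: "z \<in> path_image \<gamma>" by (simp add: \<gamma>_def)
      have "1 / (z - c) - 1 / z = c / ((z - c) * z)"
        using zc0[OF z] z0[OF z] by (simp add: field_simps)
      then have "norm (1 / (z - c) - 1 / z) = a / (norm (z - c) * M)"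
        using im\<gamma>[OF z] a by (simp add: norm_divide norm_mult c_def)
      also have "\<dots> \<le> a / ((M - a) * M)"
        using zc[OF z] a M M0 by (intro divide_left_mono mult_right_mono mult_pos_pos) auto
      finally show "norm (1 / (z - c) - 1 / z) \<le> a / ((M - a) * M)" .
    qed (use a M M0 in auto)
    then show ?thesis using M0 by simp
  qed
  \<comment> \<open>A length estimate alone would only give a bounded integral; integrating by parts gains the missing
    factor \<open>1/M\<close>, using \<open>\<bar>e\<^bsup>izt\<^esup>\<bar> \<le> 1\<close> in the upper half plane for \<open>t > 0\<close>.\<close>
  have A2: "norm A2 \<le> 2 / (t * (M - a)) + pi * M / (t * (M - a)^2)"
  proof -
    define F where "F z = E z / (\<i> * of_real t * (z - c))" for z
    have dF: "(F has_field_derivative (E z / (z - c) - E z / (\<i> * of_real t * (z - c)^2))) (at z within path_image \<gamma>)"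
      if "z \<in> path_image \<gamma>" for z
    proof -
      define d where "d = z - c"
      have d0: "d \<noteq> 0" using zc0[OF that] by (simp add: d_def)
      then have "(F has_field_derivative ((E z * (\<i> * of_real t)) * (\<i> * of_real t * d) - E z * (\<i> * of_real t))
          / ((\<i> * of_real t * d) * (\<i> * of_real t * d))) (at z within path_image \<gamma>)"
        unfolding F_def E_def d_def using t by (auto intro!: derivative_eq_intros simp: mult_ac)
      also have "((E z * (\<i> * of_real t)) * (\<i> * of_real t * d) - E z * (\<i> * of_real t))
          / ((\<i> * of_real t * d) * (\<i> * of_real t * d)) = E z / d - E z / (\<i> * of_real t * d^2)"
        using d0 t by (simp add: field_simps power2_eq_square)
      finally show ?thesis by (simp add: d_def)
    qed
    from contour_integral_primitive[OF this v\<gamma>]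
    have hF: "((\<lambda>z. E z / (z - c) - E z / (\<i> * of_real t * (z - c)^2)) has_contour_integral (F (- of_real M) - F (of_real M))) \<gamma>"
      by (simp add: ends)
    have hr: "((\<lambda>z. E z / (z - c) - (E z / (z - c) - E z / (\<i> * of_real t * (z - c)^2))) has_contour_integral (A2 - (F (- of_real M) - F (of_real M)))) \<gamma>"
      by (intro has_contour_integral_diff h2 hF)
    then have b: "norm (A2 - (F (- of_real M) - F (of_real M))) \<le> (1 / (t * (M - a)^2)) * M * (pi - 0)"
      unfolding \<gamma>_def
    proof (rule has_contour_integral_bound_part_circlepath)
      fix z assume "z \<in> path_image (part_circlepath 0 M 0 pi)"
      then have z: "z \<in> path_image \<gamma>" by (simp add: \<gamma>_def)
      have "norm (E z / (\<i> * of_real t * (z - c)^2)) = norm (E z) / (t * (norm (z - c))^2)"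
        using t by (simp add: norm_divide norm_mult norm_power)
      also have "\<dots> \<le> 1 / (t * (M - a)^2)"
        using zc[OF z] t M im\<gamma>[OF z] by (intro frac_le E1 mult_left_mono power_mono) auto
      finally show "norm (E z / (z - c) - (E z / (z - c) - E z / (\<i> * of_real t * (z - c)^2))) \<le> 1 / (t * (M - a)^2)"
        by simp
    qed (use a M M0 t in auto)
    have Fb: "norm (F z) \<le> 1 / (t * (M - a))" if "z \<in> path_image \<gamma>" for z
    proof -
      have "norm (F z) = norm (E z) / (t * norm (z - c))" using t by (simp add: F_def norm_divide norm_mult)
      also have "\<dots> \<le> 1 / (t * (M - a))"
        using zc[OF that] t M im\<gamma>[OF that] by (intro frac_le E1 mult_left_mono) auto
      finally show ?thesis .
    qed
    have "norm A2 \<le> norm (A2 - (F (- of_real M) - F (of_real M))) + (norm (F (- of_real M)) + norm (F (of_real M)))"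
      by norm
    also have "\<dots> \<le> (1 / (t * (M - a)^2)) * M * (pi - 0) + (1 / (t * (M - a)) + 1 / (t * (M - a)))"
      using ends pathstart_in_path_image[of \<gamma>] pathfinish_in_path_image[of \<gamma>]
      by (intro add_mono b Fb) auto
    finally show ?thesis by (simp add: mult.commute)
  qed
  have "(\<lambda>s. exp (\<i> * of_real s * of_real t) / (\<i> * of_real s + of_real a)) = (\<lambda>s. - \<i> * (E (of_real s) / (of_real s - c)))"
  proof
    fix s
    have "\<i> * of_real s + of_real a = \<i> * (of_real s - c)" by (simp add: c_def algebra_simps)
    then have "exp (\<i> * of_real s * of_real t) / (\<i> * of_real s + of_real a) = E (of_real s) / (\<i> * (of_real s - c))"
      by (simp add: E_def)
    also have "\<dots> = - \<i> * (E (of_real s) / (of_real s - c))"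
      using lc0[of s] by (simp add: field_simps)
    finally show "exp (\<i> * of_real s * of_real t) / (\<i> * of_real s + of_real a) = - \<i> * (E (of_real s) / (of_real s - c))" .
  qed
  then have "integral {-M..M} (\<lambda>s. exp (\<i> * of_real s * of_real t) / (\<i> * of_real s + of_real a))
     = - \<i> * integral {-M..M} (\<lambda>s. E (of_real s) / (of_real s - c))" by (simp only: integral_mult_right)
  also have "integral {-M..M} (\<lambda>s. E (of_real s) / (of_real s - c)) = E c * (2 * \<i> * of_real (arctan (M / a))) - A2 + E c * A1"
    using q0 line arc by (simp add: algebra_simps)
  finally have "integral {-M..M} (\<lambda>s. exp (\<i> * of_real s * of_real t) / (\<i> * of_real s + of_real a))
      - of_real (exp (- a * t) * (2 * arctan (M / a) + pi)) = - \<i> * E c * (A1 - \<i> * of_real pi) + \<i> * A2"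
    by (simp add: Ec algebra_simps)
  also have "norm \<dots> \<le> norm (E c) * norm (A1 - \<i> * of_real pi) + norm A2"
    by (rule order_trans[OF norm_triangle_ineq]) (simp add: norm_mult)
  also have "\<dots> \<le> 1 * (a * pi / (M - a)) + (2 / (t * (M - a)) + pi * M / (t * (M - a)^2))"
    using a by (intro add_mono mult_mono A1 A2 E1) (auto simp: c_def)
  finally show ?thesis by simp
qed

text \<open>This is the inverse Fourier transform of \<open>1/(is + a)\<close>: the transform of \<open>e\<^bsup>-at\<^esup>\<close> on \<open>t > 0\<close>.\<close>
lemma mode_integral_tendsto:
  fixes a t :: real
  assumes a: "a > 0" and t: "t > 0"
  shows "((\<lambda>M. integral {-M..M} (\<lambda>s. exp (\<i> * of_real s * of_real t) / (\<i> * of_real s + of_real a)))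
     \<longlongrightarrow> 2 * of_real pi * of_real (exp (- a * t))) at_top"
    (is "(?I \<longlongrightarrow> _) at_top")
proof -
  let ?L = "\<lambda>M. complex_of_real (exp (- a * t) * (2 * arctan (M / a) + pi))"
  let ?B = "\<lambda>M. a * pi / (M - a) + (2 / (t * (M - a)) + pi * M / (t * (M - a)^2))"
  have "(?B \<longlongrightarrow> 0) at_top" using t by real_asymp
  moreover have "\<forall>\<^sub>F M in at_top. norm (?I M - ?L M) \<le> ?B M"
    using eventually_gt_at_top[of a] by eventually_elim (rule mode_integral_error[OF a t])
  ultimately have "((\<lambda>M. ?I M - ?L M) \<longlongrightarrow> 0) at_top"
    by (rule Lim_null_comparison[rotated])
  moreover have "(?L \<longlongrightarrow> of_real (exp (- a * t) * (2 * (pi / 2) + pi))) at_top"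
    using a by (intro tendsto_intros filterlim_compose[OF tendsto_arctan_at_top]) real_asymp
  ultimately have "((\<lambda>M. (?I M - ?L M) + ?L M) \<longlongrightarrow> 0 + of_real (exp (- a * t) * (2 * (pi / 2) + pi))) at_top"
    by (rule tendsto_add)
  then show ?thesis by (simp add: algebra_simps)
qed

section \<open>Green's function and the principal value\<close>

text \<open>The function \<open>\<Phi>\<close> is the primitive found by integrating by parts twice.\<close>
lemma integral_sinh_sin:
  fixes m :: complex and k a b c :: real
  assumes "a \<le> b" and q: "m^2 + of_real k^2 \<noteq> 0"
  defines "\<Phi> \<equiv> \<lambda>y. (m * cosh (m * of_real (y - c)) * of_real (sin (k * y))
      - of_real k * sinh (m * of_real (y - c)) * of_real (cos (k * y))) / (m^2 + of_real k^2)"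
  shows "((\<lambda>y. sinh (m * of_real (y - c)) * of_real (sin (k * y))) has_integral (\<Phi> b - \<Phi> a)) {a..b}"
proof (rule fundamental_theorem_of_calculus[OF \<open>a \<le> b\<close>])
  fix y
  define N :: "complex \<Rightarrow> complex" where "N z = m * cosh (m * (z - of_real c)) * sin (of_real k * z)
      - of_real k * sinh (m * (z - of_real c)) * cos (of_real k * z)" for z
  define \<Psi> where "\<Psi> z = N z / (m^2 + of_real k^2)" for z
  define S :: complex where "S = sinh (m * (of_real y - of_real c))"
  define s' :: complex where "s' = sin (of_real k * of_real y)"
  have "(N has_field_derivative (S * s' * (m^2 + of_real k^2))) (at (of_real y))"
    unfolding N_def S_def s'_def by (auto intro!: derivative_eq_intros simp: algebra_simps power2_eq_square)
  then have "(\<Psi> has_field_derivative (S * s' * (m^2 + of_real k^2) / (m^2 + of_real k^2))) (at (of_real y))"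
    unfolding \<Psi>_def by (rule DERIV_cdivide)
  also have "S * s' * (m^2 + of_real k^2) / (m^2 + of_real k^2) = S * s'"
    using q by simp
  finally have "(\<Psi> has_field_derivative S * s') (at (of_real y))" .
  from has_vector_derivative_real_field[OF this]
  show "(\<Phi> has_vector_derivative sinh (m * of_real (y - c)) * of_real (sin (k * y))) (at y within {a..b})"
    by (simp add: \<Psi>_def N_def \<Phi>_def S_def s'_def flip: sin_of_real cos_of_real)
qed

text \<open>Green's function inverts \<open>m\<^sup>2 - d\<^sup>2/dx\<^sup>2\<close> with zero boundary values, and \<open>sin(kx)\<close> is an eigenfunction with eigenvalue
\<open>m\<^sup>2 + k\<^sup>2\<close>. The proof integrates over \<open>[0,x]\<close> and \<open>[x,1]\<close>: the boundary terms at \<open>0\<close> and \<open>1\<close> vanish, and those at \<open>x\<close>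
combine through the addition theorem for \<open>sinh\<close>.\<close>
lemma integral_green_sin:
  fixes m :: complex and k x :: real
  assumes m: "m \<noteq> 0" "sinh m \<noteq> 0" and q: "m^2 + of_real k^2 \<noteq> 0" and k: "sin k = 0" and x: "x \<in> {0..1}"
  shows "((\<lambda>y. green m x y * of_real (sin (k * y))) has_integral (of_real (sin (k * x)) / (m^2 + of_real k^2))) {0..1}"
proof -
  define c0 where "c0 = - 1 / (m * sinh m)"
  define q where "q = m^2 + of_real k^2"
  have q0: "q \<noteq> 0" using assms(3) by (simp add: q_def)
  define \<Phi> where "\<Phi> c y = (m * cosh (m * of_real (y - c)) * of_real (sin (k * y))
      - of_real k * sinh (m * of_real (y - c)) * of_real (cos (k * y))) / q" for c y
  have I: "((\<lambda>y. sinh (m * of_real (y - c)) * of_real (sin (k * y))) has_integral (\<Phi> c b - \<Phi> c a)) {a..b}"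
    if "a \<le> b" for a b c
    using integral_sinh_sin[OF that assms(3)] unfolding \<Phi>_def q_def .
  define sl where "sl = sinh (m * of_real (x - 1))"
  define sr where "sr = sinh (m * of_real x)"
  have left: "((\<lambda>y. green m x y * of_real (sin (k * y))) has_integral (c0 * sl * (\<Phi> 0 x - \<Phi> 0 0))) {0..x}"
    by (rule has_integral_eq[OF _ has_integral_mult_right[OF I]])
      (use x m in \<open>auto simp: green_def c0_def sl_def\<close>)
  have right: "((\<lambda>y. green m x y * of_real (sin (k * y))) has_integral (c0 * sr * (\<Phi> 1 1 - \<Phi> 1 x))) {x..1}"
    by (rule has_integral_eq[OF _ has_integral_mult_right[OF I]])
      (use x m in \<open>auto simp: green_def c0_def sr_def\<close>)
  have total: "((\<lambda>y. green m x y * of_real (sin (k * y))) has_integral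
      (c0 * sl * (\<Phi> 0 x - \<Phi> 0 0) + c0 * sr * (\<Phi> 1 1 - \<Phi> 1 x))) {0..1}"
    by (rule has_integral_combine[OF _ _ left right]) (use x in auto)
  have z: "\<Phi> 0 0 = 0" "\<Phi> 1 1 = 0" using k by (simp_all add: \<Phi>_def)
  define cl where "cl = cosh (m * of_real (x - 1))"
  define cr where "cr = cosh (m * of_real x)"
  have "sl * cr - cl * sr = sinh (m * of_real (x - 1) - m * of_real x)"
    by (simp only: sinh_diff sl_def cr_def cl_def sr_def)
  also have "m * of_real (x - 1) - m * of_real x = - m" by (simp add: algebra_simps)
  finally have wr: "sl * cr - cl * sr = - sinh m" by simp
  have \<Phi>x: "\<Phi> 0 x = (m * cr * of_real (sin (k * x)) - of_real k * sr * of_real (cos (k * x))) / q"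
    "\<Phi> 1 x = (m * cl * of_real (sin (k * x)) - of_real k * sl * of_real (cos (k * x))) / q"
    by (simp_all add: \<Phi>_def cr_def sr_def cl_def sl_def)
  have "c0 * sl * (\<Phi> 0 x - \<Phi> 0 0) + c0 * sr * (\<Phi> 1 1 - \<Phi> 1 x)
      = c0 * m * of_real (sin (k * x)) * (sl * cr - cl * sr) / q"
    unfolding z \<Phi>x using q0 by (simp add: field_simps)
  also have "\<dots> = of_real (sin (k * x)) / q"
    unfolding wr c0_def using m by simp
  finally show ?thesis using total by (simp add: q_def)
qed

lemma continuous_on_green:
  assumes m: "m \<noteq> 0"
  shows "continuous_on {0..1} (green m x)"
proof -
  let ?l = "\<lambda>y. - 1 / (m * sinh m) * (sinh (m * of_real (x - 1)) * sinh (m * of_real y))"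
  let ?r = "\<lambda>y. - 1 / (m * sinh m) * (sinh (m * of_real x) * sinh (m * of_real (y - 1)))"
  have c: "continuous_on X ?l" "continuous_on X ?r" for X by (intro continuous_intros)+
  have "continuous_on ({0..1} \<inter> {..x} \<union> {0..1} \<inter> {x..}) (\<lambda>y. if y \<le> x then ?l y else ?r y)"
    by (rule continuous_on_If) (use c in \<open>auto simp: mult_ac\<close>)
  also have "{0..1} \<inter> {..x} \<union> {0..1} \<inter> {x..} = {0..1::real}" by auto
  finally show ?thesis
    by (rule continuous_on_eq) (use m in \<open>simp add: green_def\<close>)
qed

text \<open>The zeros of \<open>sinh\<close> are purely imaginary, so their squares are real, whereas \<open>is\<close> is not.\<close>
lemma sinh_csqrt_imaginary:
  fixes s :: real
  assumes "s \<noteq> 0"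
  shows "sinh (csqrt (\<i> * of_real s)) \<noteq> 0"
proof
  define m where "m = csqrt (\<i> * of_real s)"
  assume "sinh (csqrt (\<i> * of_real s)) = 0"
  then have "exp m = exp (- m)" by (simp add: m_def sinh_def)
  then have "exp (m + m) = exp m * exp (- m)" by (simp only: exp_add)
  then have "exp (m + m) = 1" by (simp only: exp_minus_inverse)
  then have re: "Re m = 0" by (simp add: exp_eq_1)
  have sq: "m^2 = \<i> * of_real s" by (simp add: m_def)
  have "Im (m^2) = 0" using re by (simp add: power2_eq_square)
  then show False using sq assms by simp
qed

lemma integral_series:
  fixes T :: "nat \<Rightarrow> real \<Rightarrow> complex"
  assumes cont: "\<And>n. continuous_on {a..b} (T n)"
    and bound: "\<And>n y. y \<in> {a..b} \<Longrightarrow> norm (T n y) \<le> M n" and M: "summable M"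
    and h: "\<And>y. y \<in> {a..b} \<Longrightarrow> (\<lambda>n. T n y) sums h y"
  shows "h integrable_on {a..b}" and "(\<lambda>n. integral {a..b} (T n)) sums integral {a..b} h"
proof -
  have "uniform_limit {a..b} (\<lambda>n y. \<Sum>i<n. T i y) (\<lambda>y. \<Sum>i. T i y) sequentially"
    by (rule Weierstrass_m_test[OF bound M])
  moreover have "continuous_on {a..b} (\<lambda>y. \<Sum>i<n. T i y)" for n
    by (intro continuous_intros cont)
  ultimately obtain I J where I: "\<And>n. ((\<lambda>y. \<Sum>i<n. T i y) has_integral I n) {a..b}"
    and J: "((\<lambda>y. \<Sum>i. T i y) has_integral J) {a..b}" and lim: "I \<longlonglongrightarrow> J"
    by (rule uniform_limit_integral) auto
  have J': "(h has_integral J) {a..b}"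
    using J by (rule has_integral_eq[rotated]) (use h in \<open>auto simp: sums_iff\<close>)
  then show "h integrable_on {a..b}" by blast
  have "I n = (\<Sum>i<n. integral {a..b} (T i))" for n
  proof -
    have "((\<lambda>y. \<Sum>i<n. T i y) has_integral (\<Sum>i<n. integral {a..b} (T i))) {a..b}"
      by (intro has_integral_sum integrable_integral integrable_continuous_interval cont) simp
    with I show ?thesis by (rule has_integral_unique)
  qed
  then have "I = (\<lambda>n. \<Sum>i<n. integral {a..b} (T i))" by (rule ext)
  then show "(\<lambda>n. integral {a..b} (T n)) sums integral {a..b} h"
    using lim integral_unique[OF J'] by (simp add: sums_def)
qed

lemma integral_green_sine_series:
  fixes m :: complex and \<beta> :: "nat \<Rightarrow> real" and f :: "real \<Rightarrow> real"
  assumes m: "m \<noteq> 0" "sinh m \<noteq> 0" and q: "\<And>n. m^2 + of_real (real n * pi)^2 \<noteq> 0" and x: "x \<in> {0..1}"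
    and \<beta>: "summable (\<lambda>n. \<bar>\<beta> n\<bar>)"
    and f: "\<And>y. y \<in> {0..1} \<Longrightarrow> (\<lambda>n. \<beta> n * sin (real n * pi * y)) sums f y"
  shows "(\<lambda>n. of_real (\<beta> n * sin (real n * pi * x)) / (m^2 + of_real (real n * pi)^2))
     sums integral {0..1} (\<lambda>y. green m x y * of_real (f y))"
proof -
  have "bounded (green m x ` {0..1})"
    using continuous_on_green[OF m(1)] by (intro compact_imp_bounded compact_continuous_image) auto
  then obtain C where C: "\<And>y. y \<in> {0..1} \<Longrightarrow> norm (green m x y) \<le> C"
    unfolding bounded_iff by (metis imageI)
  have "(\<lambda>n. integral {0..1} (\<lambda>y. green m x y * of_real (\<beta> n * sin (real n * pi * y))))
     sums integral {0..1} (\<lambda>y. green m x y * of_real (f y))"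
  proof (rule integral_series(2))
    show "continuous_on {0..1} (\<lambda>y. green m x y * of_real (\<beta> n * sin (real n * pi * y)))" for n
      by (intro continuous_intros continuous_on_green m)
    show "summable (\<lambda>n. C * \<bar>\<beta> n\<bar>)" by (intro summable_mult \<beta>)
    show "(\<lambda>n. green m x y * of_real (\<beta> n * sin (real n * pi * y))) sums (green m x y * of_real (f y))"
      if "y \<in> {0..1}" for y
      by (intro sums_mult sums_of_real f that)
    show "norm (green m x y * of_real (\<beta> n * sin (real n * pi * y))) \<le> C * \<bar>\<beta> n\<bar>" if y: "y \<in> {0..1}" for n y
    proof -
      have "norm (green m x y * of_real (\<beta> n * sin (real n * pi * y)))
          = norm (green m x y) * (\<bar>\<beta> n\<bar> * \<bar>sin (real n * pi * y)\<bar>)"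
        by (simp add: norm_mult abs_mult)
      also have "\<dots> \<le> C * (\<bar>\<beta> n\<bar> * 1)"
        using C[OF y] order_trans[OF norm_ge_zero C[OF y]] by (intro mult_mono mult_left_mono) auto
      finally show ?thesis by simp
    qed
  qed
  moreover have "integral {0..1} (\<lambda>y. green m x y * of_real (\<beta> n * sin (real n * pi * y)))
      = of_real (\<beta> n * sin (real n * pi * x)) / (m^2 + of_real (real n * pi)^2)" for n
  proof -
    have "((\<lambda>y. of_real (\<beta> n) * (green m x y * of_real (sin (real n * pi * y)))) has_integral
        (of_real (\<beta> n) * (of_real (sin (real n * pi * x)) / (m^2 + of_real (real n * pi)^2)))) {0..1}"
      by (intro has_integral_mult_right integral_green_sin m q x) simp
    then have "((\<lambda>y. green m x y * of_real (\<beta> n * sin (real n * pi * y))) has_integral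
        (of_real (\<beta> n * sin (real n * pi * x)) / (m^2 + of_real (real n * pi)^2))) {0..1}"
      by (simp add: mult_ac)
    then show ?thesis by (rule integral_unique)
  qed
  ultimately show ?thesis by simp
qed

text \<open>Expanding \<open>f\<close> turns the integrand, for \<open>s \<noteq> 0\<close>, into the series of the mode integrands
\<open>\<beta> n sin(n\<pi>x) e\<^bsup>ist\<^esup>/(is + (n\<pi>)\<^sup>2)\<close>. The single point \<open>s = 0\<close> is negligible for the integral over \<open>s\<close>. Since \<open>\<bar>is + (n\<pi>)\<^sup>2\<bar> \<ge> 1\<close> for \<open>n \<ge> 1\<close>, summation and integration over \<open>[-M, M]\<close> commute, and since the
mode integrals are bounded uniformly in \<open>n\<close> and \<open>M\<close>, so do summation and \<open>M \<rightarrow> \<infinity>\<close>. The mode \<open>n = 0\<close> is singular at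
\<open>s = 0\<close> but carries the coefficient \<open>0\<close>, and is treated separately throughout.\<close>
lemma has_PV_sine_series:
  fixes \<beta> :: "nat \<Rightarrow> real" and f :: "real \<Rightarrow> real"
  assumes \<beta>: "summable (\<lambda>n. \<bar>\<beta> n\<bar>)"
    and f: "\<And>y. y \<in> {0..1} \<Longrightarrow> (\<lambda>n. \<beta> n * sin (real n * pi * y)) sums f y"
    and U: "(\<lambda>n. \<beta> n * exp (- ((real n * pi)^2) * t) * sin (real n * pi * x)) sums U"
    and x: "x \<in> {0..1}" and t: "t > 0"
  shows "(\<lambda>s. integral {0..1}
        (\<lambda>y. exp (\<i> * of_real s * of_real t) * green (csqrt (\<i> * of_real s)) x y * of_real (f y)))
      has_PV of_real U"
    (is "?h has_PV _")
proof -
  define e :: "real \<Rightarrow> complex" where "e s = exp (\<i> * of_real s * of_real t)" for s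
  define p :: "nat \<Rightarrow> real" where "p n = (real n * pi)^2" for n
  define \<gamma> where "\<gamma> n = \<beta> n * sin (real n * pi * x)" for n
  have \<gamma>0: "\<gamma> 0 = 0" by (simp add: \<gamma>_def)
  have \<gamma>_bound: "\<bar>\<gamma> n\<bar> \<le> \<bar>\<beta> n\<bar>" for n
    by (simp add: \<gamma>_def abs_mult mult_left_le)
  have p1: "p n \<ge> 1" if "n \<noteq> 0" for n
  proof -
    have "1 * 1 \<le> real n * pi" using that pi_ge_two by (intro mult_mono) auto
    then show ?thesis by (simp add: p_def one_le_power)
  qed
  have ne: "norm (e s) = 1" for s
    unfolding e_def by (metis mult.assoc mult.commute norm_exp_i_times of_real_mult)
  have D: "norm (\<i> * of_real s + of_real (p n)) \<ge> 1" if "n \<noteq> 0" for n s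
    using p1[OF that] abs_Re_le_cmod[of "\<i> * of_real s + of_real (p n)"] by simp
  define T where "T n s = of_real (\<gamma> n) * (e s / (\<i> * of_real s + of_real (p n)))" for n s
  have T_cont: "continuous_on X (T n)" for X n
  proof (cases "n = 0")
    case True
    then show ?thesis by (simp add: T_def[abs_def] \<gamma>0)
  next
    case False
    then have "\<i> * of_real s + of_real (p n) \<noteq> 0" for s using D[OF False, of s] by auto
    then show ?thesis unfolding T_def e_def by (intro continuous_intros) auto
  qed
  have T_bound: "norm (T n s) \<le> \<bar>\<beta> n\<bar>" for n s
  proof (cases "n = 0")
    case True
    then show ?thesis by (simp add: T_def \<gamma>0)
  next
    case False
    have "norm (T n s) = \<bar>\<gamma> n\<bar> / norm (\<i> * of_real s + of_real (p n))"
      by (simp add: T_def norm_mult norm_divide ne)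
    also have "\<dots> \<le> \<bar>\<beta> n\<bar> / 1" using D[OF False, of s] \<gamma>_bound[of n] by (intro frac_le) auto
    finally show ?thesis by simp
  qed
  have T_summable: "summable (\<lambda>n. T n s)" for s
    by (rule summable_comparison_test[OF _ \<beta>]) (use T_bound in auto)
  define H where "H s = (\<Sum>n. T n s)" for s
  have H_int: "H integrable_on {a..b}" and H_sums: "(\<lambda>n. integral {a..b} (T n)) sums integral {a..b} H" for a b
    by (rule integral_series[OF T_cont T_bound \<beta>]; simp add: H_def summable_sums T_summable)+
  have hH: "?h s = H s" if s: "s \<noteq> 0" for s
  proof -
    define m where "m = csqrt (\<i> * of_real s)"
    have m2: "m^2 = \<i> * of_real s" by (simp add: m_def)
    have "m \<noteq> 0" using s by (simp add: m_def)
    have "m^2 + of_real (real n * pi)^2 \<noteq> 0" for n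
      using s unfolding m2 by (auto simp: complex_eq_iff)
    moreover have "sinh m \<noteq> 0" unfolding m_def by (rule sinh_csqrt_imaginary[OF s])
    ultimately have "(\<lambda>n. e s * (of_real (\<beta> n * sin (real n * pi * x)) / (m^2 + of_real (real n * pi)^2)))
        sums (e s * integral {0..1} (\<lambda>y. green m x y * of_real (f y)))"
      by (intro sums_mult integral_green_sine_series \<open>m \<noteq> 0\<close> x \<beta> f)
    moreover have "e s * (of_real (\<beta> n * sin (real n * pi * x)) / (m^2 + of_real (real n * pi)^2)) = T n s" for n
      unfolding m2 T_def p_def \<gamma>_def by simp
    ultimately have "(\<lambda>n. T n s) sums (e s * integral {0..1} (\<lambda>y. green m x y * of_real (f y)))"
      by simp
    then have "H s = e s * integral {0..1} (\<lambda>y. green m x y * of_real (f y))"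
      by (simp add: H_def sums_iff)
    then show ?thesis by (simp add: e_def m_def mult.assoc flip: integral_mult_right)
  qed
  have h_int: "?h integrable_on {a..b}" and h_eq: "integral {a..b} ?h = integral {a..b} H" for a b
  proof -
    show "?h integrable_on {a..b}"
      by (rule integrable_spike[OF H_int, of "{0}"]) (use hH in auto)
    show "integral {a..b} ?h = integral {a..b} H"
      by (rule integral_spike[of "{0}"]) (use hH in auto)
  qed
  define K where "K = (2 + pi) / t"
  have K0: "K \<ge> 0" using t by (simp add: K_def)
  define J where "J n M = integral {-M..M} (T n)" for n M
  have J_eq: "J n M = of_real (\<gamma> n) * integral {-M..M} (\<lambda>s. e s / (\<i> * of_real s + of_real (p n)))" for n M
    unfolding J_def T_def by (rule integral_mult_right)
  have J_bound: "norm (J n M) \<le> K * \<bar>\<beta> n\<bar>" if M: "M \<ge> 0" for n M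
  proof (cases "n = 0")
    case True
    then show ?thesis using K0 by (simp add: J_eq \<gamma>0)
  next
    case False
    have "norm (integral {-M..M} (\<lambda>s. e s / (\<i> * of_real s + of_real (p n)))) \<le> (2 + pi) / (t * p n)"
      unfolding e_def by (rule mode_integral_bound) (use p1[OF False] t M in auto)
    also have "\<dots> \<le> K" unfolding K_def using p1[OF False] t by (intro divide_left_mono) auto
    finally have "\<bar>\<gamma> n\<bar> * norm (integral {-M..M} (\<lambda>s. e s / (\<i> * of_real s + of_real (p n)))) \<le> \<bar>\<beta> n\<bar> * K"
      by (intro mult_mono \<gamma>_bound) auto
    then show ?thesis by (simp add: J_eq norm_mult mult.commute)
  qed
  have J_lim: "(J n \<longlongrightarrow> 2 * of_real pi * of_real (\<gamma> n * exp (- p n * t))) at_top" for n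
  proof (cases "n = 0")
    case True
    have "J n = (\<lambda>M. 0)" by (rule ext) (simp only: J_eq True \<gamma>0 of_real_0 mult_zero_left)
    then show ?thesis by (simp add: True \<gamma>0)
  next
    case False
    have "p n > 0" using p1[OF False] by linarith
    from tendsto_mult_left[OF mode_integral_tendsto[OF this t], of "of_real (\<gamma> n)"]
    have "(J n \<longlongrightarrow> of_real (\<gamma> n) * (2 * of_real pi * of_real (exp (- p n * t)))) at_top"
      unfolding e_def[symmetric] J_eq[symmetric] .
    then show ?thesis by (simp only: of_real_mult mult_ac)
  qed
  have "((\<lambda>M. \<Sum>n. J n M) \<longlongrightarrow> (\<Sum>n. 2 * of_real pi * of_real (\<gamma> n * exp (- p n * t)))) at_top"
  proof (rule conjunct2[OF conjunct2[OF tannerys_theorem[where a = J, OF J_lim _ summable_mult[OF \<beta>, of K]]]])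
    show "\<forall>\<^sub>F (n, M) in at_top \<times>\<^sub>F at_top. norm (J n M) \<le> K * \<bar>\<beta> n\<bar>"
      unfolding eventually_prod_filter case_prod_conv
      by (intro exI[of _ "\<lambda>_. True"] exI[of _ "\<lambda>M. M \<ge> 0"] conjI eventually_ge_at_top) (auto simp: J_bound)
  qed simp
  moreover have "(\<Sum>n. J n M) = integral {-M..M} ?h" for M
    unfolding h_eq J_def using H_sums[of "-M" M] by (simp add: sums_iff)
  moreover have "(\<Sum>n. 2 * of_real pi * of_real (\<gamma> n * exp (- p n * t))) = (2 * of_real pi * of_real U :: complex)"
  proof -
    have "(\<lambda>n. 2 * of_real pi * of_real (\<gamma> n * exp (- p n * t)) :: complex) sums (2 * of_real pi * of_real U)"
      using U by (intro sums_mult sums_of_real) (simp add: \<gamma>_def p_def mult_ac)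
    then show ?thesis by (simp add: sums_iff)
  qed
  ultimately have "((\<lambda>M. integral {-M..M} ?h) \<longlongrightarrow> 2 * of_real pi * of_real U) at_top" by simp
  from tendsto_mult_left[OF this, of "1 / (2 * of_real pi)"]
  have "((\<lambda>M. 1 / (2 * of_real pi) * integral {-M..M} ?h) \<longlongrightarrow> of_real U) at_top" by simp
  then show ?thesis unfolding has_PV_def using h_int by blast
qed

section \<open>The representation formula\<close>

theorem theorem2p3:
  fixes f :: "real \<Rightarrow> real"
  assumes "C2_on f {0..1}"
    and "f 0 = 0" and "f 1 = 0"
    and "deriv_within {0..1} (deriv_within {0..1} f) 0 = 0"
    and "deriv_within {0..1} (deriv_within {0..1} f) 1 = 0"
  shows "\<exists>u\<^sub>1. bounded_heat_solution f u\<^sub>1 \<and>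
    (\<forall>v. bounded_heat_solution f v \<longrightarrow> (\<forall>x\<in>{0..1}. \<forall>t\<ge>0. v x t = u\<^sub>1 x t)) \<and>
    (\<forall>x\<in>{0..1}. \<forall>t>0.
      (\<lambda>s. integral {0..1}
        (\<lambda>y. exp (\<i> * of_real s * of_real t) * green (csqrt (\<i> * of_real s)) x y * of_real (f y)))
      has_PV of_real (u\<^sub>1 x t))"
proof -
  let ?f1 = "deriv_within {0..1} f"
  let ?f2 = "deriv_within {0..1} ?f1"
  have diff: "f differentiable_on {0..1}" "?f1 differentiable_on {0..1}" and cont: "continuous_on {0..1} ?f2"
    using assms(1) by (auto simp: C2_on_def twice_differentiable_on_def)
  obtain u \<beta> where u: "bounded_heat_solution f u" and \<beta>: "summable (\<lambda>n. \<bar>\<beta> n\<bar>)"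
    and series: "\<And>x t. x \<in> {0..1} \<Longrightarrow> t \<ge> 0 \<Longrightarrow>
      (\<lambda>n. \<beta> n * exp (- ((real n * pi)^2) * t) * sin (real n * pi * x)) sums u x t"
    using heat_solution_exists[OF diff[THEN has_deriv_within] cont assms(2-5)] by blast
  have f_series: "(\<lambda>n. \<beta> n * sin (real n * pi * y)) sums f y" if "y \<in> {0..1}" for y
    using series[OF that, of 0] u that by (simp add: bounded_heat_solution_def heat_solution_def)
  show ?thesis
  proof (intro exI[of _ u] conjI allI impI ballI)
    fix v and x t :: real
    assume "bounded_heat_solution f v" "x \<in> {0..1}" "0 \<le> t"
    with u show "v x t = u x t"
      by (intro heat_solution_unique[of f v u]) (auto simp: bounded_heat_solution_def)
  next
    fix x t :: real
    assume "x \<in> {0..1}" "0 < t"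
    then show "(\<lambda>s. integral {0..1}
        (\<lambda>y. exp (\<i> * of_real s * of_real t) * green (csqrt (\<i> * of_real s)) x y * of_real (f y)))
      has_PV of_real (u x t)"
      using series[of x t] by (intro has_PV_sine_series[OF \<beta> f_series]) auto
  qed (rule u)
qed

end
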